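(* Let $n\ge 2$, let $k_1,\dots,k_n$ be integers with $k_i>1$ for all $i$, and let $l_2,\dots,l_n$ be positive integers. Let $G=G(k_1,\dots,k_n,l_2,\dots,l_n)$ be the Artin group whose underlying labeled graph has vertices $u,u_1,\dots,u_n$ and exactly the following edges: for each $1\le i\le n$ an edge joining $u$ and $u_i$ with label $2k_i$, and for each $2\le i\le n$ an edge joining $u_1$ and $u_i$ with label $2l_i+1$. Let $\chi:G\to\mathbb{R}$ be a homomorphism (to the additive group of $\mathbb{R}$) with $\chi(u_1)=-1$ and $\chi(u)=1$. Suppose moreover that $$\sum_{\substack{2\le i\le n\\ k_i \text{ is a power of } 2}}\frac{1}{2l_i+1}<1 .$$ Then $[\chi]\notin\Sigma^1(G)$, i.e. $[\chi]\in\Sigma^1(G)^c=S(G)\setminus\Sigma^1(G)$.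
   Context: Artin groups: for a finite simplicial graph $\mathcal{G}$ with edges labeled by integers greater than one, the Artin group with underlying graph $\mathcal{G}$ is the group with generators the vertices of $\mathcal{G}$ and, for each edge with vertices $a,b$ and label $m\ge 2$, the relation $\underbrace{aba\cdots}_{m\text{ factors}}=\underbrace{bab\cdots}_{m\text{ factors}}$ (and no other relations). The invariant $\Sigma^1$: for a finitely generated group $G$, $S(G)$ is the set of equivalence classes $[\chi]=\mathbb{R}_{>0}\chi$ of non-zero homomorphisms $\chi:G\to\mathbb{R}$, where $\chi_1\sim\chi_2$ if and only if $\chi_1=r\chi_2$ for some real $r>0$. Put $G_\chi=\{g\in G\mid\chi(g)\ge 0\}$, a submonoid of $G$. Then $$\Sigma^1(G)=\Sigma^1(G,\mathbb{Z})=\{[\chi]\in S(G)\mid \text{the trivial module } \mathbb{Z} \text{ is of type } FP_1 \text{ as a left } \mathbb{Z}[G_\chi]\text{-module}\},$$ where a module is of type $FP_1$ if it has a projective resolution with finitely generated projectives in dimensions $\le 1$. *)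

theory Defs
  imports Complex_Main "HOL-Algebra.AbelCoset" "HOL-Algebra.Module"
begin

section \<open>Groups given by generators and relators\<close>

text \<open>
  A word is a list of letters \<open>(s, True)\<close>, standing for the generator \<open>s\<close>, and
  \<open>(s, False)\<close>, standing for its formal inverse.
\<close>

type_synonym 'v word = "('v \<times> bool) list"

definition words :: "'v set \<Rightarrow> 'v word set" where
  "words S = lists (S \<times> UNIV)"

inductive_set word_cong :: "'v set \<Rightarrow> ('v word \<times> 'v word) set \<Rightarrow> ('v word \<times> 'v word) set"
  for S :: "'v set" and Rel :: "('v word \<times> 'v word) set" where
  refl: "w \<in> words S \<Longrightarrow> (w, w) \<in> word_cong S Rel"
| sym: "(v, w) \<in> word_cong S Rel \<Longrightarrow> (w, v) \<in> word_cong S Rel"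
| trans: "\<lbrakk>(v, w) \<in> word_cong S Rel; (w, x) \<in> word_cong S Rel\<rbrakk> \<Longrightarrow> (v, x) \<in> word_cong S Rel"
| cancel: "\<lbrakk>v \<in> words S; w \<in> words S; s \<in> S\<rbrakk>
    \<Longrightarrow> (v @ [(s, e), (s, \<not> e)] @ w, v @ w) \<in> word_cong S Rel"
| rel: "\<lbrakk>(p, q) \<in> Rel; p \<in> words S; q \<in> words S; v \<in> words S; w \<in> words S\<rbrakk>
    \<Longrightarrow> (v @ p @ w, v @ q @ w) \<in> word_cong S Rel"

definition presented_group :: "'v set \<Rightarrow> ('v word \<times> 'v word) set \<Rightarrow> 'v word set monoid" where
  "presented_group S Rel =
    \<lparr>carrier = words S // word_cong S Rel,
     monoid.mult = (\<lambda>A B. \<Union>v\<in>A. \<Union>w\<in>B. word_cong S Rel `` {v @ w}),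
     one = word_cong S Rel `` {[]}\<rparr>"

definition presented_gen :: "'v set \<Rightarrow> ('v word \<times> 'v word) set \<Rightarrow> 'v \<Rightarrow> 'v word set" where
  "presented_gen S Rel s = word_cong S Rel `` {[(s, True)]}"


section \<open>Artin groups\<close>

text \<open>
  A labelled graph consists of a vertex set \<open>V\<close> and a set \<open>E\<close> of triples \<open>(a, b, m)\<close>, one for
  each edge \<open>{a, b}\<close> with label \<open>m\<close>. The order of the two ends is immaterial, since the
  braid relation is symmetric in them.
\<close>

definition labelled_graph :: "'v set \<Rightarrow> ('v \<times> 'v \<times> nat) set \<Rightarrow> bool" where
  "labelled_graph V E \<longleftrightarrow> finite V
    \<and> (\<forall>(a, b, m)\<in>E. a \<in> V \<and> b \<in> V \<and> a \<noteq> b \<and> m > 1)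
    \<and> (\<forall>(a, b, m)\<in>E. \<forall>(a', b', m')\<in>E. {a, b} = {a', b'} \<longrightarrow> (a, b, m) = (a', b', m'))"

primrec alternating :: "nat \<Rightarrow> 'v \<Rightarrow> 'v \<Rightarrow> 'v word" where
  "alternating 0 a b = []"
| "alternating (Suc m) a b = (a, True) # alternating m b a"

definition artin_relations :: "('v \<times> 'v \<times> nat) set \<Rightarrow> ('v word \<times> 'v word) set" where
  "artin_relations E = {(alternating m a b, alternating m b a) | a b m. (a, b, m) \<in> E}"

definition artin_group :: "'v set \<Rightarrow> ('v \<times> 'v \<times> nat) set \<Rightarrow> 'v word set monoid" where
  "artin_group V E = presented_group V (artin_relations E)"

definition artin_gen :: "'v set \<Rightarrow> ('v \<times> 'v \<times> nat) set \<Rightarrow> 'v \<Rightarrow> 'v word set" where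
  "artin_gen V E = presented_gen V (artin_relations E)"

datatype vertex = U | Ui nat

definition G_vertices :: "nat \<Rightarrow> vertex set" where
  "G_vertices n = insert U (Ui ` {1..n})"

definition G_edges :: "nat \<Rightarrow> (nat \<Rightarrow> nat) \<Rightarrow> (nat \<Rightarrow> nat) \<Rightarrow> (vertex \<times> vertex \<times> nat) set" where
  "G_edges n k l = {(U, Ui i, 2 * k i) | i. i \<in> {1..n}} \<union> {(Ui 1, Ui i, 2 * l i + 1) | i. i \<in> {2..n}}"

definition G_group :: "nat \<Rightarrow> (nat \<Rightarrow> nat) \<Rightarrow> (nat \<Rightarrow> nat) \<Rightarrow> vertex word set monoid" where
  "G_group n k l = artin_group (G_vertices n) (G_edges n k l)"

definition G_gen :: "nat \<Rightarrow> (nat \<Rightarrow> nat) \<Rightarrow> (nat \<Rightarrow> nat) \<Rightarrow> vertex \<Rightarrow> vertex word set" where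
  "G_gen n k l = artin_gen (G_vertices n) (G_edges n k l)"

lemma labelled_graph_G:
  assumes "\<forall>i\<in>{1..n}. k i > 1" and "\<forall>i\<in>{2..n}. l i > 0"
  shows "labelled_graph (G_vertices n) (G_edges n k l)"
proof -
  have "2 * k i > 1" if "i \<in> {1..n}" for i
    using assms(1) that by fastforce
  then show ?thesis
    using assms by (auto simp: labelled_graph_def G_vertices_def G_edges_def doubleton_eq_iff)
qed


section \<open>Left modules over a ring\<close>

text \<open>
  The library locale \<open>module\<close> requires a commutative ring. Its record type is reused; as there,
  the fields \<open>mult\<close> and \<open>one\<close> of a module are ignored.
\<close>

locale left_module = R?: ring R + M?: abelian_group M
  for R :: "('r, 'x) ring_scheme" (structure) and M :: "('r, 'a, 'y) module_scheme" (structure) +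
  assumes smult_closed:
      "\<lbrakk>r \<in> carrier R; x \<in> carrier M\<rbrakk> \<Longrightarrow> r \<odot>\<^bsub>M\<^esub> x \<in> carrier M"
    and smult_l_distr:
      "\<lbrakk>r \<in> carrier R; s \<in> carrier R; x \<in> carrier M\<rbrakk>
        \<Longrightarrow> (r \<oplus> s) \<odot>\<^bsub>M\<^esub> x = r \<odot>\<^bsub>M\<^esub> x \<oplus>\<^bsub>M\<^esub> s \<odot>\<^bsub>M\<^esub> x"
    and smult_r_distr:
      "\<lbrakk>r \<in> carrier R; x \<in> carrier M; y \<in> carrier M\<rbrakk>
        \<Longrightarrow> r \<odot>\<^bsub>M\<^esub> (x \<oplus>\<^bsub>M\<^esub> y) = r \<odot>\<^bsub>M\<^esub> x \<oplus>\<^bsub>M\<^esub> r \<odot>\<^bsub>M\<^esub> y"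
    and smult_assoc:
      "\<lbrakk>r \<in> carrier R; s \<in> carrier R; x \<in> carrier M\<rbrakk>
        \<Longrightarrow> (r \<otimes> s) \<odot>\<^bsub>M\<^esub> x = r \<odot>\<^bsub>M\<^esub> (s \<odot>\<^bsub>M\<^esub> x)"
    and smult_one:
      "x \<in> carrier M \<Longrightarrow> \<one> \<odot>\<^bsub>M\<^esub> x = x"

definition module_hom ::
  "('r, 'x) ring_scheme \<Rightarrow> ('r, 'a, 'y) module_scheme \<Rightarrow> ('r, 'b, 'z) module_scheme \<Rightarrow> ('a \<Rightarrow> 'b) set"
where
  "module_hom R M N = {f \<in> hom (add_monoid M) (add_monoid N).
    \<forall>r\<in>carrier R. \<forall>x\<in>carrier M. f (r \<odot>\<^bsub>M\<^esub> x) = r \<odot>\<^bsub>N\<^esub> f x}"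

definition fin_gen_module :: "('r, 'x) ring_scheme \<Rightarrow> ('r, 'a, 'y) module_scheme \<Rightarrow> bool" where
  "fin_gen_module R M \<longleftrightarrow> (\<exists>A. finite A \<and> A \<subseteq> carrier M \<and>
    (\<forall>x\<in>carrier M. \<exists>c\<in>A \<rightarrow> carrier R. x = (\<Oplus>\<^bsub>M\<^esub>a\<in>A. c a \<odot>\<^bsub>M\<^esub> a)))"

text \<open>The free module on the basis \<open>B\<close>: finitely supported functions from \<open>B\<close> to \<open>R\<close>.\<close>

definition free_module :: "('r, 'x) ring_scheme \<Rightarrow> 'b set \<Rightarrow> ('r, 'b \<Rightarrow> 'r) module" where
  "free_module R B =
    \<lparr>carrier = {f. (\<forall>x. f x \<in> carrier R) \<and> {x. f x \<noteq> \<zero>\<^bsub>R\<^esub>} \<subseteq> B \<and> finite {x. f x \<noteq> \<zero>\<^bsub>R\<^esub>}},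
     monoid.mult = undefined, one = undefined,
     zero = (\<lambda>x. \<zero>\<^bsub>R\<^esub>),
     add = (\<lambda>f g x. f x \<oplus>\<^bsub>R\<^esub> g x),
     smult = (\<lambda>r f x. r \<otimes>\<^bsub>R\<^esub> f x)\<rparr>"

text \<open>
  A projective module is a direct summand of a free module. Taking the basis inside the element
  type of \<open>P\<close> is no restriction: if \<open>P\<close> is a direct summand of any free module, then the
  canonical surjection onto \<open>P\<close> from the free module on \<open>carrier P\<close> splits.
\<close>

definition projective_module :: "('r, 'x) ring_scheme \<Rightarrow> ('r, 'a, 'y) module_scheme \<Rightarrow> bool" where
  "projective_module R P \<longleftrightarrow> left_module R P \<and>
    (\<exists>(B :: 'a set) i p. i \<in> module_hom R P (free_module R B) \<and> p \<in> module_hom R (free_module R B) P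
      \<and> (\<forall>x\<in>carrier P. p (i x) = x))"

definition projective_resolution ::
  "('r, 'x) ring_scheme \<Rightarrow> ('r, 'a, 'y) module_scheme \<Rightarrow> (nat \<Rightarrow> ('r, 'm) module)
    \<Rightarrow> (nat \<Rightarrow> 'm \<Rightarrow> 'm) \<Rightarrow> ('m \<Rightarrow> 'a) \<Rightarrow> bool"
where
  "projective_resolution R M P d \<epsilon> \<longleftrightarrow>
    (\<forall>i. projective_module R (P i)) \<and>
    \<epsilon> \<in> module_hom R (P 0) M \<and>
    (\<forall>i. d i \<in> module_hom R (P (Suc i)) (P i)) \<and>
    \<epsilon> ` carrier (P 0) = carrier M \<and>
    d 0 ` carrier (P 1) = a_kernel (P 0) M \<epsilon> \<and>
    (\<forall>i. d (Suc i) ` carrier (P (Suc (Suc i))) = a_kernel (P (Suc i)) (P i) (d i))"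

text \<open>
  Type \<open>FP\<^sub>n\<close>. HOL cannot quantify over types inside a definition, so the type \<open>'m\<close> holding
  the elements of the modules of the resolution is a parameter. A theorem refuting this
  property with \<open>'m\<close> a type variable excludes resolutions by modules of every size.
\<close>

definition FP_module ::
  "'m itself \<Rightarrow> nat \<Rightarrow> ('r, 'x) ring_scheme \<Rightarrow> ('r, 'a, 'y) module_scheme \<Rightarrow> bool"
where
  "FP_module TYPE('m) n R M \<longleftrightarrow> left_module R M \<and>
    (\<exists>(P :: nat \<Rightarrow> ('r, 'm) module) d \<epsilon>.
      projective_resolution R M P d \<epsilon> \<and> (\<forall>i\<le>n. fin_gen_module R (P i)))"


section \<open>Monoid rings and the trivial module\<close>

definition monoid_ring :: "('g, 'x) monoid_scheme \<Rightarrow> ('g \<Rightarrow> int) ring" where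
  "monoid_ring M =
    \<lparr>carrier = {f. finite {g. f g \<noteq> 0} \<and> {g. f g \<noteq> 0} \<subseteq> carrier M},
     monoid.mult = (\<lambda>f h g. \<Sum>(x, y) | f x \<noteq> 0 \<and> h y \<noteq> 0 \<and> x \<otimes>\<^bsub>M\<^esub> y = g. f x * h y),
     one = (\<lambda>g. if g = \<one>\<^bsub>M\<^esub> then 1 else 0),
     zero = (\<lambda>g. 0),
     add = (\<lambda>f h g. f g + h g)\<rparr>"

text \<open>The integers, with every monoid element acting as the identity.\<close>

definition trivial_module :: "('g \<Rightarrow> int, int) module" where
  "trivial_module =
    \<lparr>carrier = UNIV, monoid.mult = undefined, one = undefined, zero = 0, add = (+),
     smult = (\<lambda>f z. (\<Sum>g | f g \<noteq> 0. f g) * z)\<rparr>"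


section \<open>The character sphere and the first Sigma invariant\<close>

definition real_group :: "real monoid" where
  "real_group = \<lparr>carrier = UNIV, monoid.mult = (+), one = 0\<rparr>"

definition nonzero_chars :: "('g, 'x) monoid_scheme \<Rightarrow> ('g \<Rightarrow> real) set" where
  "nonzero_chars G = {\<chi> \<in> hom G real_group. \<exists>g\<in>carrier G. \<chi> g \<noteq> 0}"

text \<open>
  Only the values on \<open>carrier G\<close> matter: functions agreeing there are identified.
\<close>

definition char_rel :: "('g, 'x) monoid_scheme \<Rightarrow> (('g \<Rightarrow> real) \<times> ('g \<Rightarrow> real)) set" where
  "char_rel G = {(\<chi>, \<psi>). \<chi> \<in> nonzero_chars G \<and> \<psi> \<in> nonzero_chars G \<and>
    (\<exists>r>0. \<forall>g\<in>carrier G. \<chi> g = r * \<psi> g)}"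

definition char_class :: "('g, 'x) monoid_scheme \<Rightarrow> ('g \<Rightarrow> real) \<Rightarrow> ('g \<Rightarrow> real) set" where
  "char_class G \<chi> = char_rel G `` {\<chi>}"

definition char_sphere :: "('g, 'x) monoid_scheme \<Rightarrow> ('g \<Rightarrow> real) set set" where
  "char_sphere G = nonzero_chars G // char_rel G"

definition nonneg_monoid :: "('g, 'x) monoid_scheme \<Rightarrow> ('g \<Rightarrow> real) \<Rightarrow> ('g, 'x) monoid_scheme" where
  "nonneg_monoid G \<chi> = G\<lparr>carrier := {g \<in> carrier G. \<chi> g \<ge> 0}\<rparr>"

definition Sigma1 :: "'m itself \<Rightarrow> ('g, 'x) monoid_scheme \<Rightarrow> ('g \<Rightarrow> real) set set" where
  "Sigma1 TYPE('m) G = {char_class G \<chi> | \<chi>. \<chi> \<in> nonzero_chars G \<and>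
    FP_module TYPE('m) 1 (monoid_ring (nonneg_monoid G \<chi>)) trivial_module}"


section \<open>The constructions are groups, rings and modules\<close>

lemma word_cong_words: "(v, w) \<in> word_cong S Rel \<Longrightarrow> v \<in> words S \<and> w \<in> words S"
  by (induction rule: word_cong.induct) (auto simp: words_def)

lemma equiv_word_cong: "equiv (words S) (word_cong S Rel)"
proof (rule equivI)
  show "word_cong S Rel \<subseteq> words S \<times> words S"
    using word_cong_words by fast
  show "refl_on (words S) (word_cong S Rel)"
    by (rule refl_onI) (rule word_cong.refl)
  show "sym (word_cong S Rel)" by (rule symI) (rule word_cong.sym)
  show "trans (word_cong S Rel)" by (rule transI) (rule word_cong.trans)
qed

lemma word_cong_context:
  assumes "(v, w) \<in> word_cong S Rel" "x \<in> words S" "y \<in> words S"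
  shows "(x @ v @ y, x @ w @ y) \<in> word_cong S Rel"
  using assms
proof (induction rule: word_cong.induct)
  case (refl w) then show ?case by (auto intro: word_cong.refl simp: words_def)
next
  case (sym v w) then show ?case by (auto intro: word_cong.sym)
next
  case (trans v w x) then show ?case by (auto intro: word_cong.trans)
next
  case (cancel v w s e)
  then show ?case using word_cong.cancel[of "x @ v" S "w @ y" s e Rel] by (simp add: words_def)
next
  case (rel p q v w)
  then show ?case using word_cong.rel[of p q Rel S "x @ v" "w @ y"] by (simp add: words_def)
qed

lemma word_cong_append:
  assumes "(v, v') \<in> word_cong S Rel" "(w, w') \<in> word_cong S Rel"
  shows "(v @ w, v' @ w') \<in> word_cong S Rel"
proof -
  have "v' \<in> words S" "w \<in> words S" using assms word_cong_words by blast+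
  then show ?thesis
    using word_cong_context[OF assms(1), of "[]" w] word_cong_context[OF assms(2), of v' "[]"]
    by (auto intro: word_cong.trans simp: words_def)
qed

lemma presented_group_mult:
  assumes "v \<in> words S" "w \<in> words S"
  shows "word_cong S Rel `` {v} \<otimes>\<^bsub>presented_group S Rel\<^esub> word_cong S Rel `` {w}
    = word_cong S Rel `` {v @ w}"
proof -
  have "congruent2 (word_cong S Rel) (word_cong S Rel) (\<lambda>v w. word_cong S Rel `` {v @ w})"
    by (rule congruent2I'[OF equiv_class_eq[OF equiv_word_cong]]) (auto intro: word_cong_append)
  then show ?thesis
    using UN_equiv_class2[OF equiv_word_cong equiv_word_cong _ assms]
    by (simp add: presented_group_def)
qed

lemma word_cong_inverse:
  assumes "w \<in> words S"
  shows "(rev (map (\<lambda>(s, e). (s, \<not> e)) w) @ w, []) \<in> word_cong S Rel"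
  using assms
proof (induction w)
  case Nil then show ?case by (auto intro: word_cong.refl simp: words_def)
next
  case (Cons a w)
  obtain s e where a: "a = (s, e)" by force
  let ?i = "\<lambda>w. rev (map (\<lambda>(s, e). (s, \<not> e)) w)"
  have "?i w \<in> words S" "w \<in> words S" "s \<in> S"
    using Cons.prems a by (auto simp: words_def)
  then show ?case
    using word_cong.cancel[of "?i w" S w s "\<not> e" Rel] Cons.IH a by (auto intro: word_cong.trans)
qed

lemma group_presented_group: "group (presented_group S Rel)"
proof -
  let ?C = "\<lambda>w. word_cong S Rel `` {w}" and ?G = "presented_group S Rel"
  have car: "carrier ?G = ?C ` words S" by (auto simp: presented_group_def quotient_def)
  have one: "\<one>\<^bsub>?G\<^esub> = ?C []" by (simp add: presented_group_def)
  have app: "v @ w \<in> words S" "[] \<in> words S" if "v \<in> words S" "w \<in> words S" for v w :: "'a word"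
    using that by (auto simp: words_def)
  show ?thesis
  proof (rule groupI)
    fix x assume "x \<in> carrier ?G"
    then obtain w where w: "w \<in> words S" "x = ?C w" using car by auto
    let ?v = "rev (map (\<lambda>(s, e). (s, \<not> e)) w)"
    have v: "?v \<in> words S" using w by (auto simp: words_def)
    have "?C ?v \<otimes>\<^bsub>?G\<^esub> x = ?C []"
      using presented_group_mult[OF v w(1)] w(2) word_cong_inverse[OF w(1)]
        equiv_class_eq[OF equiv_word_cong] by metis
    then show "\<exists>y\<in>carrier ?G. y \<otimes>\<^bsub>?G\<^esub> x = \<one>\<^bsub>?G\<^esub>" using v car one by auto
  qed (auto simp: car one presented_group_mult app, auto simp: words_def presented_group_mult)
qed

lemma monoid_ring_mult_expand:
  assumes "finite A" "finite B" "{x. f x \<noteq> 0} \<subseteq> A" "{y. h y \<noteq> 0} \<subseteq> B"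
  shows "(f \<otimes>\<^bsub>monoid_ring M\<^esub> h) g = (\<Sum>x\<in>A. \<Sum>y\<in>B. if x \<otimes>\<^bsub>M\<^esub> y = g then f x * h y else 0)"
proof -
  have "(f \<otimes>\<^bsub>monoid_ring M\<^esub> h) g
    = (\<Sum>(x, y)\<in>A \<times> B. if x \<otimes>\<^bsub>M\<^esub> y = g then f x * h y else 0)"
    unfolding monoid_ring_def using assms
    by (auto intro!: sum.mono_neutral_cong_left split: if_splits)
  then show ?thesis by (simp add: sum.cartesian_product)
qed

lemma monoid_ring_mult_closed:
  assumes M: "Group.monoid M" and f: "f \<in> carrier (monoid_ring M)" and h: "h \<in> carrier (monoid_ring M)"
  shows "f \<otimes>\<^bsub>monoid_ring M\<^esub> h \<in> carrier (monoid_ring M)"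
    and "{g. (f \<otimes>\<^bsub>monoid_ring M\<^esub> h) g \<noteq> 0} \<subseteq> (\<lambda>(x, y). x \<otimes>\<^bsub>M\<^esub> y) ` ({x. f x \<noteq> 0} \<times> {y. h y \<noteq> 0})"
proof -
  interpret Group.monoid M by fact
  let ?A = "{x. f x \<noteq> 0}" and ?B = "{y. h y \<noteq> 0}"
  have fin: "finite ?A" "finite ?B" and car: "?A \<subseteq> carrier M" "?B \<subseteq> carrier M"
    using f h by (auto simp: monoid_ring_def)
  show sub: "{g. (f \<otimes>\<^bsub>monoid_ring M\<^esub> h) g \<noteq> 0} \<subseteq> (\<lambda>(x, y). x \<otimes>\<^bsub>M\<^esub> y) ` (?A \<times> ?B)"
  proof
    fix g assume "g \<in> {g. (f \<otimes>\<^bsub>monoid_ring M\<^esub> h) g \<noteq> 0}"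
    then have "(\<Sum>x\<in>?A. \<Sum>y\<in>?B. if x \<otimes>\<^bsub>M\<^esub> y = g then f x * h y else 0) \<noteq> 0"
      using monoid_ring_mult_expand[OF fin, of f h M g] by simp
    then obtain x where x: "x \<in> ?A"
      and "(\<Sum>y\<in>?B. if x \<otimes>\<^bsub>M\<^esub> y = g then f x * h y else 0) \<noteq> 0"
      by (rule sum.not_neutral_contains_not_neutral)
    then obtain y where "y \<in> ?B" "(if x \<otimes>\<^bsub>M\<^esub> y = g then f x * h y else 0) \<noteq> 0"
      by (elim sum.not_neutral_contains_not_neutral)
    then have "x \<in> ?A" "y \<in> ?B" "x \<otimes>\<^bsub>M\<^esub> y = g"
      using x by (simp_all split: if_splits)
    then show "g \<in> (\<lambda>(x, y). x \<otimes>\<^bsub>M\<^esub> y) ` (?A \<times> ?B)" by force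
  qed
  have "finite {g. (f \<otimes>\<^bsub>monoid_ring M\<^esub> h) g \<noteq> 0}"
    by (rule finite_subset[OF sub]) (use fin in auto)
  moreover have "{g. (f \<otimes>\<^bsub>monoid_ring M\<^esub> h) g \<noteq> 0} \<subseteq> carrier M"
    using sub car by fastforce
  ultimately show "f \<otimes>\<^bsub>monoid_ring M\<^esub> h \<in> carrier (monoid_ring M)"
    by (simp add: monoid_ring_def)
qed

lemma monoid_ring_pair:
  fixes t :: "'g \<Rightarrow> int"
  assumes M: "Group.monoid M" and f: "f \<in> carrier (monoid_ring M)" and h: "h \<in> carrier (monoid_ring M)"
  shows "(\<Sum>g | (f \<otimes>\<^bsub>monoid_ring M\<^esub> h) g \<noteq> 0. (f \<otimes>\<^bsub>monoid_ring M\<^esub> h) g * t g)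
    = (\<Sum>x | f x \<noteq> 0. \<Sum>y | h y \<noteq> 0. f x * h y * t (x \<otimes>\<^bsub>M\<^esub> y))"
proof -
  let ?A = "{x. f x \<noteq> 0}" and ?B = "{y. h y \<noteq> 0}"
  let ?C = "(\<lambda>(x, y). x \<otimes>\<^bsub>M\<^esub> y) ` (?A \<times> ?B)" and ?m = "f \<otimes>\<^bsub>monoid_ring M\<^esub> h"
  have fin: "finite ?A" "finite ?B" using f h by (auto simp: monoid_ring_def)
  then have C: "finite ?C" by auto
  have "(\<Sum>g | ?m g \<noteq> 0. ?m g * t g) = (\<Sum>g\<in>?C. ?m g * t g)"
    by (rule sum.mono_neutral_left[OF C monoid_ring_mult_closed(2)[OF M f h]]) auto
  also have "\<dots> = (\<Sum>g\<in>?C. \<Sum>x\<in>?A. \<Sum>y\<in>?B. if x \<otimes>\<^bsub>M\<^esub> y = g then f x * h y * t g else 0)"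
    by (simp add: monoid_ring_mult_expand[OF fin] sum_distrib_right if_distrib[of "\<lambda>z. z * _"] cong: if_cong)
  also have "\<dots> = (\<Sum>x\<in>?A. \<Sum>g\<in>?C. \<Sum>y\<in>?B. if x \<otimes>\<^bsub>M\<^esub> y = g then f x * h y * t g else 0)"
    by (rule sum.swap)
  also have "\<dots> = (\<Sum>x\<in>?A. \<Sum>y\<in>?B. \<Sum>g\<in>?C. if x \<otimes>\<^bsub>M\<^esub> y = g then f x * h y * t g else 0)"
    by (rule sum.cong[OF HOL.refl]) (rule sum.swap)
  also have "\<dots> = (\<Sum>x\<in>?A. \<Sum>y\<in>?B. f x * h y * t (x \<otimes>\<^bsub>M\<^esub> y))"
    using C by (intro sum.cong HOL.refl) (auto simp: sum.delta')
  finally show ?thesis .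
qed

lemma ring_monoid_ring:
  fixes M :: "('g, 'x) monoid_scheme"
  assumes M: "Group.monoid M"
  shows "ring (monoid_ring M)"
proof -
  interpret Group.monoid M by fact
  let ?R = "monoid_ring M"
  have carI: "f \<in> carrier ?R" if "finite {g. f g \<noteq> 0}" "{g. f g \<noteq> 0} \<subseteq> carrier M" for f
    using that by (simp add: monoid_ring_def)
  have fin: "finite {g. f g \<noteq> 0}" and sub: "{g. f g \<noteq> 0} \<subseteq> carrier M" if "f \<in> carrier ?R" for f
    using that by (auto simp: monoid_ring_def)
  have add: "(f \<oplus>\<^bsub>?R\<^esub> h) g = f g + h g" for f h g by (simp add: monoid_ring_def)
  have addc: "f \<oplus>\<^bsub>?R\<^esub> h \<in> carrier ?R" if "f \<in> carrier ?R" "h \<in> carrier ?R" for f h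
  proof (rule carI)
    have s: "{g. (f \<oplus>\<^bsub>?R\<^esub> h) g \<noteq> 0} \<subseteq> {g. f g \<noteq> 0} \<union> {g. h g \<noteq> 0}" by (auto simp: add)
    show "finite {g. (f \<oplus>\<^bsub>?R\<^esub> h) g \<noteq> 0}"
      by (rule finite_subset[OF s]) (use fin that in auto)
    show "{g. (f \<oplus>\<^bsub>?R\<^esub> h) g \<noteq> 0} \<subseteq> carrier M"
      using s sub that by blast
  qed
  have test: "f g = (\<Sum>x | f x \<noteq> 0. f x * (if x = g then 1 else 0))" if "f \<in> carrier ?R" for f g
    using fin[OF that] by (simp add: if_distrib sum.delta cong: if_cong)
  note mc = monoid_ring_mult_closed(1)[OF M]
  show ?thesis
  proof (rule ringI)
    show "abelian_group ?R"
    proof (rule abelian_groupI)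
      fix x assume "x \<in> carrier ?R"
      then show "\<exists>y\<in>carrier ?R. y \<oplus>\<^bsub>?R\<^esub> x = \<zero>\<^bsub>?R\<^esub>"
        by (intro bexI[of _ "\<lambda>g. - x g"]) (auto simp: monoid_ring_def)
    qed (auto simp: addc, auto simp: monoid_ring_def)
    have one: "\<one>\<^bsub>?R\<^esub> \<in> carrier ?R" "\<And>g. \<one>\<^bsub>?R\<^esub> g = (if g = \<one>\<^bsub>M\<^esub> then 1 else 0)"
      by (auto simp: monoid_ring_def)
    have ones: "{g. \<one>\<^bsub>?R\<^esub> g \<noteq> 0} = {\<one>\<^bsub>M\<^esub>}" by (auto simp: one)
    show "Group.monoid ?R"
    proof (rule monoidI)
      fix f assume f: "f \<in> carrier ?R"
      show "\<one>\<^bsub>?R\<^esub> \<otimes>\<^bsub>?R\<^esub> f = f"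
      proof
        fix g
        have "(\<one>\<^bsub>?R\<^esub> \<otimes>\<^bsub>?R\<^esub> f) g = (\<Sum>y | f y \<noteq> 0. if \<one>\<^bsub>M\<^esub> \<otimes>\<^bsub>M\<^esub> y = g then f y else 0)"
          using monoid_ring_mult_expand[of "{\<one>\<^bsub>M\<^esub>}" "{y. f y \<noteq> 0}" "\<one>\<^bsub>?R\<^esub>" f M g] ones fin[OF f]
          by (simp add: one cong: if_cong)
        also have "\<dots> = (\<Sum>y | f y \<noteq> 0. if y = g then f y else 0)"
          using sub[OF f] by (intro sum.cong) auto
        finally show "(\<one>\<^bsub>?R\<^esub> \<otimes>\<^bsub>?R\<^esub> f) g = f g" using fin[OF f] by (simp add: sum.delta)
      qed
      show "f \<otimes>\<^bsub>?R\<^esub> \<one>\<^bsub>?R\<^esub> = f"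
      proof
        fix g
        have "(f \<otimes>\<^bsub>?R\<^esub> \<one>\<^bsub>?R\<^esub>) g = (\<Sum>y | f y \<noteq> 0. if y \<otimes>\<^bsub>M\<^esub> \<one>\<^bsub>M\<^esub> = g then f y else 0)"
          using monoid_ring_mult_expand[of "{y. f y \<noteq> 0}" "{\<one>\<^bsub>M\<^esub>}" f "\<one>\<^bsub>?R\<^esub>" M g] ones fin[OF f]
          by (simp add: one cong: if_cong)
        also have "\<dots> = (\<Sum>y | f y \<noteq> 0. if y = g then f y else 0)"
          using sub[OF f] by (intro sum.cong) auto
        finally show "(f \<otimes>\<^bsub>?R\<^esub> \<one>\<^bsub>?R\<^esub>) g = f g" using fin[OF f] by (simp add: sum.delta)
      qed
    next
      fix f h k assume c: "f \<in> carrier ?R" "h \<in> carrier ?R" "k \<in> carrier ?R"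
      show "f \<otimes>\<^bsub>?R\<^esub> h \<otimes>\<^bsub>?R\<^esub> k = f \<otimes>\<^bsub>?R\<^esub> (h \<otimes>\<^bsub>?R\<^esub> k)"
      proof
        fix g :: 'g
        let ?t = "\<lambda>x. if x = g then 1 else (0::int)"
        have e: "(p \<otimes>\<^bsub>?R\<^esub> q) g = (\<Sum>x | p x \<noteq> 0. \<Sum>y | q y \<noteq> 0. p x * q y * ?t (x \<otimes>\<^bsub>M\<^esub> y))"
          if "p \<in> carrier ?R" "q \<in> carrier ?R" for p q
          using test[OF mc[OF that], of g] monoid_ring_pair[OF M that, of ?t] by simp
        have "(f \<otimes>\<^bsub>?R\<^esub> h \<otimes>\<^bsub>?R\<^esub> k) g = (\<Sum>w | (f \<otimes>\<^bsub>?R\<^esub> h) w \<noteq> 0. (f \<otimes>\<^bsub>?R\<^esub> h) w * (\<Sum>z | k z \<noteq> 0. k z * ?t (w \<otimes>\<^bsub>M\<^esub> z)))"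
          by (simp only: e[OF mc[OF c(1,2)] c(3)] sum_distrib_left mult.assoc)
        also have "\<dots> = (\<Sum>x | f x \<noteq> 0. \<Sum>y | h y \<noteq> 0. f x * h y * (\<Sum>z | k z \<noteq> 0. k z * ?t (x \<otimes>\<^bsub>M\<^esub> y \<otimes>\<^bsub>M\<^esub> z)))"
          by (rule monoid_ring_pair[OF M c(1,2)])
        also have "\<dots> = (\<Sum>x | f x \<noteq> 0. f x * (\<Sum>y | h y \<noteq> 0. \<Sum>z | k z \<noteq> 0. h y * k z * ?t (x \<otimes>\<^bsub>M\<^esub> (y \<otimes>\<^bsub>M\<^esub> z))))"
          unfolding sum_distrib_left mult.assoc
          using sub[OF c(1)] sub[OF c(2)] sub[OF c(3)] by (intro sum.cong HOL.refl) (auto simp: m_assoc subset_iff)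
        also have "\<dots> = (\<Sum>x | f x \<noteq> 0. f x * (\<Sum>w | (h \<otimes>\<^bsub>?R\<^esub> k) w \<noteq> 0. (h \<otimes>\<^bsub>?R\<^esub> k) w * ?t (x \<otimes>\<^bsub>M\<^esub> w)))"
          by (simp only: monoid_ring_pair[OF M c(2,3)])
        also have "\<dots> = (f \<otimes>\<^bsub>?R\<^esub> (h \<otimes>\<^bsub>?R\<^esub> k)) g"
          by (simp only: e[OF c(1) mc[OF c(2,3)]] sum_distrib_left mult.assoc)
        finally show "(f \<otimes>\<^bsub>?R\<^esub> h \<otimes>\<^bsub>?R\<^esub> k) g = (f \<otimes>\<^bsub>?R\<^esub> (h \<otimes>\<^bsub>?R\<^esub> k)) g" .
      qed
    qed (use one mc in auto)
  next
    fix f h k assume c: "f \<in> carrier ?R" "h \<in> carrier ?R" "k \<in> carrier ?R"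
    let ?A = "{x. f x \<noteq> 0} \<union> {x. h x \<noteq> 0} \<union> {x. k x \<noteq> 0}"
    have A: "finite ?A" using fin c by auto
    have s: "{x. (f \<oplus>\<^bsub>?R\<^esub> h) x \<noteq> 0} \<subseteq> ?A" by (auto simp: add)
    have e: "(p \<otimes>\<^bsub>?R\<^esub> q) g = (\<Sum>x\<in>?A. \<Sum>y\<in>?A. if x \<otimes>\<^bsub>M\<^esub> y = g then p x * q y else 0)"
      if "{x. p x \<noteq> 0} \<subseteq> ?A" "{x. q x \<noteq> 0} \<subseteq> ?A" for p q g
      by (rule monoid_ring_mult_expand[OF A A that])
    show "(f \<oplus>\<^bsub>?R\<^esub> h) \<otimes>\<^bsub>?R\<^esub> k = f \<otimes>\<^bsub>?R\<^esub> k \<oplus>\<^bsub>?R\<^esub> h \<otimes>\<^bsub>?R\<^esub> k"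
      unfolding fun_eq_iff add
      by (subst (1 2 3) e) (auto simp: add sum.distrib[symmetric] distrib_right intro!: sum.cong)
    show "k \<otimes>\<^bsub>?R\<^esub> (f \<oplus>\<^bsub>?R\<^esub> h) = k \<otimes>\<^bsub>?R\<^esub> f \<oplus>\<^bsub>?R\<^esub> k \<otimes>\<^bsub>?R\<^esub> h"
      unfolding fun_eq_iff add
      by (subst (1 2 3) e) (auto simp: add sum.distrib[symmetric] distrib_left intro!: sum.cong)
  qed
qed

lemma left_module_trivial_module:
  fixes M :: "('a, 'x) monoid_scheme"
  assumes M: "Group.monoid M"
  shows "left_module (monoid_ring M) trivial_module"
proof -
  let ?R = "monoid_ring M"
  interpret R: ring ?R by (rule ring_monoid_ring[OF M])
  have ab: "abelian_group (trivial_module :: ('a \<Rightarrow> int, int) module)"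
  proof (rule abelian_groupI)
    fix x :: int assume "x \<in> carrier (trivial_module :: ('a \<Rightarrow> int, int) module)"
    show "\<exists>y\<in>carrier (trivial_module :: ('a \<Rightarrow> int, int) module).
        y \<oplus>\<^bsub>trivial_module :: ('a \<Rightarrow> int, int) module\<^esub> x = \<zero>\<^bsub>trivial_module :: ('a \<Rightarrow> int, int) module\<^esub>"
      by (rule bexI[of _ "- x"]) (auto simp: trivial_module_def)
  qed (auto simp: trivial_module_def)
  have sum: "(\<Sum>g | f g \<noteq> 0. f g) = sum f A" if "finite A" "{g. f g \<noteq> 0} \<subseteq> A" for f :: "'a \<Rightarrow> int" and A
    by (rule sum.mono_neutral_left) (use that in auto)
  have add: "(\<Sum>g | (f \<oplus>\<^bsub>?R\<^esub> h) g \<noteq> 0. (f \<oplus>\<^bsub>?R\<^esub> h) g) = (\<Sum>g | f g \<noteq> 0. f g) + (\<Sum>g | h g \<noteq> 0. h g)"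
    if "f \<in> carrier ?R" "h \<in> carrier ?R" for f h
  proof -
    let ?A = "{x. f x \<noteq> 0} \<union> {x. h x \<noteq> 0}"
    have "finite ?A" using that by (auto simp: monoid_ring_def)
    then show ?thesis
      by (subst (1 2 3) sum[of ?A]) (auto simp: monoid_ring_def sum.distrib)
  qed
  have mul: "(\<Sum>g | (f \<otimes>\<^bsub>?R\<^esub> h) g \<noteq> 0. (f \<otimes>\<^bsub>?R\<^esub> h) g) = (\<Sum>g | f g \<noteq> 0. f g) * (\<Sum>g | h g \<noteq> 0. h g)"
    if "f \<in> carrier ?R" "h \<in> carrier ?R" for f h
    using monoid_ring_pair[OF M that, of "\<lambda>_. 1"] by (simp add: sum_product)
  have one: "(\<Sum>g | \<one>\<^bsub>?R\<^esub> g \<noteq> 0. \<one>\<^bsub>?R\<^esub> g) = 1"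
    by (simp add: monoid_ring_def cong: if_cong)
  show ?thesis
  proof (intro left_module.intro left_module_axioms.intro R.ring_axioms ab)
  qed (auto simp: trivial_module_def add mul one distrib_left distrib_right)
qed

lemma left_module_free_module:
  assumes "ring R"
  shows "left_module R (free_module R B)"
proof -
  interpret R: ring R by fact
  have cl: "(\<lambda>x. f x \<oplus>\<^bsub>R\<^esub> g x) \<in> carrier (free_module R B)"
    if "f \<in> carrier (free_module R B)" "g \<in> carrier (free_module R B)" for f g
  proof -
    have "{x. f x \<oplus>\<^bsub>R\<^esub> g x \<noteq> \<zero>\<^bsub>R\<^esub>} \<subseteq> {x. f x \<noteq> \<zero>\<^bsub>R\<^esub>} \<union> {x. g x \<noteq> \<zero>\<^bsub>R\<^esub>}" by auto
    then show ?thesis using that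
      by (auto simp: free_module_def intro: finite_subset) 
  qed
  have cs: "(\<lambda>x. r \<otimes>\<^bsub>R\<^esub> f x) \<in> carrier (free_module R B)"
    if "f \<in> carrier (free_module R B)" "r \<in> carrier R" for f r
  proof -
    have "{x. r \<otimes>\<^bsub>R\<^esub> f x \<noteq> \<zero>\<^bsub>R\<^esub>} \<subseteq> {x. f x \<noteq> \<zero>\<^bsub>R\<^esub>}" using that by auto
    then show ?thesis using that
      by (auto simp: free_module_def intro: finite_subset) 
  qed
  have ab: "abelian_group (free_module R B)"
  proof (rule abelian_groupI)
    fix f assume f: "f \<in> carrier (free_module R B)"
    then have "{x. \<ominus>\<^bsub>R\<^esub> f x \<noteq> \<zero>\<^bsub>R\<^esub>} \<subseteq> {x. f x \<noteq> \<zero>\<^bsub>R\<^esub>}" by (auto simp: free_module_def)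
    with f show "\<exists>y\<in>carrier (free_module R B). y \<oplus>\<^bsub>free_module R B\<^esub> f = \<zero>\<^bsub>free_module R B\<^esub>"
      by (intro bexI[of _ "\<lambda>x. \<ominus>\<^bsub>R\<^esub> f x"]) (auto simp: free_module_def R.l_neg intro: finite_subset)
  next
    show "x \<oplus>\<^bsub>free_module R B\<^esub> y \<in> carrier (free_module R B)"
      if "x \<in> carrier (free_module R B)" "y \<in> carrier (free_module R B)" for x y
      using cl[OF that] by (simp add: free_module_def)
  qed (auto simp: free_module_def R.a_ac fun_eq_iff)
  show ?thesis
  proof (intro left_module.intro left_module_axioms.intro R.ring_axioms ab)
    show "r \<odot>\<^bsub>free_module R B\<^esub> x \<in> carrier (free_module R B)"
      if "r \<in> carrier R" "x \<in> carrier (free_module R B)" for r x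
      using cs[OF that(2,1)] by (simp add: free_module_def)
  qed (auto simp: free_module_def R.l_distr R.r_distr R.m_assoc fun_eq_iff)
qed

lemma monoid_nonneg_monoid:
  assumes "group G" and "\<chi> \<in> hom G real_group"
  shows "Group.monoid (nonneg_monoid G \<chi>)"
proof -
  interpret group G by fact
  have m: "\<chi> (x \<otimes>\<^bsub>G\<^esub> y) = \<chi> x + \<chi> y" if "x \<in> carrier G" "y \<in> carrier G" for x y
    using assms(2) that by (auto simp: hom_def real_group_def)
  have "\<chi> \<one>\<^bsub>G\<^esub> = 0" using m[of "\<one>\<^bsub>G\<^esub>" "\<one>\<^bsub>G\<^esub>"] by simp
  then show ?thesis
    by (intro Group.monoidI) (auto simp: nonneg_monoid_def m m_assoc)
qed

lemma artin_relation_holds: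
  assumes "labelled_graph V E" "(a, b, m) \<in> E"
  shows "word_cong V (artin_relations E) `` {alternating m a b} = word_cong V (artin_relations E) `` {alternating m b a}"
proof -
  have w: "alternating m a b \<in> words V" if "a \<in> V" "b \<in> V" for a b and m
    using that by (induction m arbitrary: a b) (auto simp: words_def)
  have "a \<in> V" "b \<in> V" using assms by (auto simp: labelled_graph_def)
  moreover have "(alternating m a b, alternating m b a) \<in> artin_relations E"
    using assms(2) by (auto simp: artin_relations_def)
  ultimately have "(alternating m a b, alternating m b a) \<in> word_cong V (artin_relations E)"
    using word_cong.rel[of "alternating m a b" "alternating m b a" "artin_relations E" V "[]" "[]"] w
    by (simp add: words_def)
  then show ?thesis by (rule equiv_class_eq[OF equiv_word_cong])
qed

lemma group_G_group: "group (G_group n k l)"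
  unfolding G_group_def artin_group_def by (rule group_presented_group)

end

theory Submission
  imports Defs "HOL-Number_Theory.Cong" "HOL-Computational_Algebra.Primes"
begin

text \<open>
  Write \<open>M\<close> for the monoid \<open>G\<^sub>\<chi>\<close>. If \<open>[\<chi>]\<close> were in \<open>\<Sigma>\<^sup>1(G)\<close>, Schanuel's argument would make the
  augmentation ideal of \<open>\<int>[M]\<close> a finitely generated left ideal
  (\<open>FP_module_1_augmentation_ideal_fg\<close>). To contradict this, let \<open>G\<close> act from the right on a set
  \<open>Y\<close> with a height function such that \<open>g\<close> raises heights by \<open>\<chi>(g)\<close>, and let \<open>D\<close> be a
  derivation of \<open>G\<close> into the functions on \<open>Y\<close> such that every \<open>D(g)\<close> vanishes above some height.
  Translating a function by an element of \<open>M\<close> does not raise its support, so finitely many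
  generators would bound the supports of all \<open>D(g)\<close> with \<open>g \<in> M\<close> by one common height. It is thus
  enough that these supports are unbounded (\<open>Sigma1_complement_criterion\<close>); when \<open>D(u) = 0\<close>, this
  follows from \<open>D(u\<^sub>i) \<noteq> 0\<close> for some \<open>i\<close>, by conjugating with powers of \<open>u\<close>.

  The odd edges make \<open>u\<^sub>i\<close> conjugate to \<open>u\<^sub>1\<close>, so \<open>\<chi>(u\<^sub>i) = -1\<close> for all \<open>i\<close>. Take \<open>Y = \<int> \<times> \<int>\<close>, where \<open>u\<close>
  raises the first coordinate \<open>j\<close> by one and \<open>u\<^sub>i\<close> lowers it by one and adds \<open>\<epsilon>\<^sub>i(j)\<close> to the second.
  A derivation with \<open>D(u) = 0\<close> is then a choice of weights \<open>d\<^sub>i(j, x)\<close> on the edges of the Schreier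
  graph, \<open>D(w)\<close> being the total weight along the path that reads \<open>w\<close>, and it is well defined when
  both sides of every relation have equal weight. As functions of \<open>x\<close> the weights are taken in a
  finite group \<open>F\<close> of functions modulo \<open>k\<^sub>1\<close>, in which shifting \<open>x\<close> plays the part of
  multiplication by roots of unity: for a prime \<open>q\<^sub>i\<close> dividing \<open>k\<^sub>i\<close>, the shift by \<open>\<epsilon>\<^sub>i(j)\<close> acts as a
  \<open>q\<^sub>i\<close>-th root of unity \<open>\<beta>\<^sub>i\<^sub>,\<^sub>j\<close>. The relations then read as follows.

    \<^item> Even edge at \<open>u\<^sub>i\<close>: the sum of the first \<open>k\<^sub>i\<close> powers of \<open>\<beta>\<^sub>i\<^sub>,\<^sub>j\<close> kills \<open>d\<^sub>i(j, \<cdot>)\<close>. For \<open>i = 1\<close> take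
      \<open>\<beta>\<^sub>1\<^sub>,\<^sub>j = 1\<close>: the sum is \<open>k\<^sub>1 = 0\<close>. For \<open>i \<ge> 2\<close> the sum vanishes when \<open>\<beta>\<^sub>i\<^sub>,\<^sub>j \<noteq> 1\<close>, and otherwise
      \<open>d\<^sub>i(j, \<cdot>) = 0\<close> is demanded.
    \<^item> Odd edge at \<open>u\<^sub>i\<close>, of label \<open>m = 2l\<^sub>i + 1\<close>: the alternating product of \<open>\<beta>\<^sub>i\<^sub>,\<^sub>j\<close> over any \<open>m\<close>
      consecutive \<open>j\<close> must be \<open>1\<close>, and one linear equation in the weights must hold at each height.

  An odd number \<open>m \<ge> 3\<close> of nontrivial \<open>q\<close>-th roots of unity can have product \<open>1\<close> when \<open>q\<close> is odd. For
  \<open>q = 2\<close> all of them are \<open>-1\<close>, the product is \<open>-1\<close>, and one in \<open>m\<close> has to be replaced by \<open>1\<close>. Since \<open>q\<^sub>i\<close>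
  can be chosen odd unless \<open>k\<^sub>i\<close> is a power of two, this is where the sum in the hypothesis comes
  from. On weights supported in \<open>0 \<le> j < L\<close> there remain \<open>nL - \<Sum> L / (2l\<^sub>i + 1)\<close> unknowns in \<open>F\<close>,
  against \<open>(n - 1) L + O(1)\<close> equations. If the sum is less than one and \<open>L\<close> is large, the pigeonhole
  principle gives two families of weights with the same defects, and their difference is the
  required nonzero derivation.
\<close>

section \<open>The augmentation ideal and type FP1\<close>

definition aug :: "('g \<Rightarrow> int) \<Rightarrow> int" where
  "aug f = (\<Sum>g | f g \<noteq> 0. f g)"

lemma aug_superset: "finite A \<Longrightarrow> {g. f g \<noteq> 0} \<subseteq> A \<Longrightarrow> aug f = sum f A"
  unfolding aug_def by (rule sum.mono_neutral_left) auto

lemma monoid_ring_carrierD: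
  "f \<in> carrier (monoid_ring M) \<Longrightarrow> finite {g. f g \<noteq> 0}"
  "f \<in> carrier (monoid_ring M) \<Longrightarrow> f g \<noteq> 0 \<Longrightarrow> g \<in> carrier M"
  by (auto simp: monoid_ring_def)

lemma monoid_ring_simps:
  "\<zero>\<^bsub>monoid_ring M\<^esub> = (\<lambda>g. 0)"
  "f \<oplus>\<^bsub>monoid_ring M\<^esub> h = (\<lambda>g. f g + h g)"
  "\<one>\<^bsub>monoid_ring M\<^esub> = (\<lambda>g. if g = \<one>\<^bsub>M\<^esub> then 1 else 0)"
  by (simp_all add: monoid_ring_def)

lemma trivial_module_simps:
  "carrier trivial_module = UNIV"
  "f \<odot>\<^bsub>trivial_module\<^esub> z = aug f * z"
  "x \<oplus>\<^bsub>trivial_module\<^esub> y = x + y"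
  "\<zero>\<^bsub>trivial_module\<^esub> = 0"
  by (simp_all add: trivial_module_def aug_def)

lemma free_module_simps:
  "\<zero>\<^bsub>free_module R B\<^esub> = (\<lambda>b. \<zero>\<^bsub>R\<^esub>)"
  "x \<oplus>\<^bsub>free_module R B\<^esub> y = (\<lambda>b. x b \<oplus>\<^bsub>R\<^esub> y b)"
  "r \<odot>\<^bsub>free_module R B\<^esub> x = (\<lambda>b. r \<otimes>\<^bsub>R\<^esub> x b)"
  by (simp_all add: free_module_def)

lemma free_module_carrierD:
  assumes "x \<in> carrier (free_module R B)"
  shows "finite {b. x b \<noteq> \<zero>\<^bsub>R\<^esub>}" "{b. x b \<noteq> \<zero>\<^bsub>R\<^esub>} \<subseteq> B" "x b \<in> carrier R"
  using assms by (auto simp: free_module_def)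

lemma module_hom_add:
  "f \<in> module_hom R M N \<Longrightarrow> x \<in> carrier M \<Longrightarrow> y \<in> carrier M \<Longrightarrow> f (x \<oplus>\<^bsub>M\<^esub> y) = f x \<oplus>\<^bsub>N\<^esub> f y"
  and module_hom_smult:
  "f \<in> module_hom R M N \<Longrightarrow> r \<in> carrier R \<Longrightarrow> x \<in> carrier M \<Longrightarrow> f (r \<odot>\<^bsub>M\<^esub> x) = r \<odot>\<^bsub>N\<^esub> f x"
  and module_hom_closed: "f \<in> module_hom R M N \<Longrightarrow> x \<in> carrier M \<Longrightarrow> f x \<in> carrier N"
  by (auto simp: module_hom_def hom_def)

lemma module_hom_zero:
  assumes "left_module R M" "left_module R N" "f \<in> module_hom R M N"
  shows "f \<zero>\<^bsub>M\<^esub> = \<zero>\<^bsub>N\<^esub>"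
proof -
  interpret M: left_module R M by fact
  interpret N: left_module R N by fact
  have "f \<zero>\<^bsub>M\<^esub> = f \<zero>\<^bsub>M\<^esub> \<oplus>\<^bsub>N\<^esub> f \<zero>\<^bsub>M\<^esub>"
    using module_hom_add[OF assms(3), of "\<zero>\<^bsub>M\<^esub>" "\<zero>\<^bsub>M\<^esub>"] by simp
  with module_hom_closed[OF assms(3), of "\<zero>\<^bsub>M\<^esub>"] show ?thesis
    by (metis N.M.add.r_cancel_one' M.M.zero_closed)
qed

text \<open>
  The homomorphism from a free module to the monoid ring that sends the basis element \<open>b\<close> to
  \<open>z b\<close> times the unit, written out with integer sums in place of sums in the ring.
\<close>

definition free_aug_lift :: "('b \<Rightarrow> int) \<Rightarrow> ('b \<Rightarrow> 'g \<Rightarrow> int) \<Rightarrow> 'g \<Rightarrow> int" where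
  "free_aug_lift z x g = (\<Sum>b | x b \<noteq> (\<lambda>g. 0). x b g * z b)"

lemma free_aug_lift_superset:
  assumes "finite S" "{b. x b \<noteq> (\<lambda>g. 0)} \<subseteq> S"
  shows "free_aug_lift z x g = (\<Sum>b\<in>S. x b g * z b)"
  unfolding free_aug_lift_def using assms by (intro sum.mono_neutral_left) auto

lemma free_aug_lift_closed:
  assumes x: "x \<in> carrier (free_module (monoid_ring M) B)"
  shows "free_aug_lift z x \<in> carrier (monoid_ring M)"
proof -
  let ?S = "{b. x b \<noteq> (\<lambda>g. 0)}"
  have fin: "finite ?S" and xb: "x b \<in> carrier (monoid_ring M)" for b
    using free_module_carrierD[OF x] by (auto simp: monoid_ring_simps)
  have s: "{g. free_aug_lift z x g \<noteq> 0} \<subseteq> (\<Union>b\<in>?S. {g. x b g \<noteq> 0})"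
  proof
    fix g assume "g \<in> {g. free_aug_lift z x g \<noteq> 0}"
    then have "(\<Sum>b\<in>?S. x b g * z b) \<noteq> 0" by (simp add: free_aug_lift_def)
    then obtain b where "b \<in> ?S" "x b g * z b \<noteq> 0" by (rule sum.not_neutral_contains_not_neutral)
    then show "g \<in> (\<Union>b\<in>?S. {g. x b g \<noteq> 0})" by auto
  qed
  moreover have "finite (\<Union>b\<in>?S. {g. x b g \<noteq> 0})"
    using fin monoid_ring_carrierD(1)[OF xb] by blast
  ultimately have "finite {g. free_aug_lift z x g \<noteq> 0}" by (rule finite_subset)
  moreover have "{g. free_aug_lift z x g \<noteq> 0} \<subseteq> carrier M"
    using s monoid_ring_carrierD(2)[OF xb] by fastforce
  ultimately show ?thesis by (simp add: monoid_ring_def)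
qed

lemma free_aug_lift_add:
  assumes x: "x \<in> carrier (free_module (monoid_ring M) B)" and y: "y \<in> carrier (free_module (monoid_ring M) B)"
  shows "free_aug_lift z (x \<oplus>\<^bsub>free_module (monoid_ring M) B\<^esub> y)
    = free_aug_lift z x \<oplus>\<^bsub>monoid_ring M\<^esub> free_aug_lift z y"
proof
  fix g
  let ?S = "{b. x b \<noteq> (\<lambda>g. 0)} \<union> {b. y b \<noteq> (\<lambda>g. 0)}"
  have S: "finite ?S"
    using free_module_carrierD(1)[OF x] free_module_carrierD(1)[OF y] by (simp add: monoid_ring_simps)
  have s: "{b. (x \<oplus>\<^bsub>free_module (monoid_ring M) B\<^esub> y) b \<noteq> (\<lambda>g. 0)} \<subseteq> ?S"
    by (auto simp: free_module_simps monoid_ring_simps)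
  show "free_aug_lift z (x \<oplus>\<^bsub>free_module (monoid_ring M) B\<^esub> y) g
    = (free_aug_lift z x \<oplus>\<^bsub>monoid_ring M\<^esub> free_aug_lift z y) g"
    unfolding free_aug_lift_superset[OF S s] monoid_ring_simps
    by (subst (1 2) free_aug_lift_superset[OF S])
      (auto simp: free_module_simps monoid_ring_simps sum.distrib distrib_right)
qed

lemma free_aug_lift_smult:
  assumes M: "Group.monoid M" and x: "x \<in> carrier (free_module (monoid_ring M) B)"
    and r: "r \<in> carrier (monoid_ring M)"
  shows "free_aug_lift z (r \<odot>\<^bsub>free_module (monoid_ring M) B\<^esub> x)
    = r \<otimes>\<^bsub>monoid_ring M\<^esub> free_aug_lift z x"
proof
  fix g
  let ?R = "monoid_ring M"
  interpret R: ring ?R by (rule ring_monoid_ring[OF M])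
  let ?S = "{b. x b \<noteq> (\<lambda>g. 0)}"
  let ?A = "{a. r a \<noteq> 0}"
  have S: "finite ?S" and xb: "x b \<in> carrier ?R" for b
    using free_module_carrierD[OF x] by (auto simp: monoid_ring_simps)
  have A: "finite ?A" using r by (rule monoid_ring_carrierD)
  define C where "C = (\<Union>b\<in>?S. {g. x b g \<noteq> 0})"
  have C: "finite C" unfolding C_def using S monoid_ring_carrierD(1)[OF xb] by blast
  have xC: "{h. x b h \<noteq> 0} \<subseteq> C" for b unfolding C_def by (fastforce simp: fun_eq_iff)
  have lC: "{h. free_aug_lift z x h \<noteq> 0} \<subseteq> C"
  proof
    fix h assume "h \<in> {h. free_aug_lift z x h \<noteq> 0}"
    then have "(\<Sum>b\<in>?S. x b h * z b) \<noteq> 0" by (simp add: free_aug_lift_def)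
    then obtain b where "b \<in> ?S" "x b h * z b \<noteq> 0" by (rule sum.not_neutral_contains_not_neutral)
    then show "h \<in> C" by (auto simp: C_def)
  qed
  have "(r \<otimes>\<^bsub>?R\<^esub> free_aug_lift z x) g
      = (\<Sum>a\<in>?A. \<Sum>h\<in>C. if a \<otimes>\<^bsub>M\<^esub> h = g then r a * free_aug_lift z x h else 0)"
    by (rule monoid_ring_mult_expand[OF A C _ lC]) simp
  also have "\<dots> = (\<Sum>a\<in>?A. \<Sum>h\<in>C. \<Sum>b\<in>?S. (if a \<otimes>\<^bsub>M\<^esub> h = g then r a * x b h else 0) * z b)"
    by (intro sum.cong HOL.refl) (simp add: free_aug_lift_def sum_distrib_left mult.assoc)
  also have "\<dots> = (\<Sum>a\<in>?A. \<Sum>b\<in>?S. \<Sum>h\<in>C. (if a \<otimes>\<^bsub>M\<^esub> h = g then r a * x b h else 0) * z b)"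
    by (rule sum.cong[OF HOL.refl]) (rule sum.swap)
  also have "\<dots> = (\<Sum>b\<in>?S. \<Sum>a\<in>?A. \<Sum>h\<in>C. (if a \<otimes>\<^bsub>M\<^esub> h = g then r a * x b h else 0) * z b)"
    by (rule sum.swap)
  also have "\<dots> = (\<Sum>b\<in>?S. (r \<otimes>\<^bsub>?R\<^esub> x b) g * z b)"
    by (rule sum.cong[OF HOL.refl])
      (simp add: monoid_ring_mult_expand[OF A C subset_refl xC] sum_distrib_right)
  also have "\<dots> = free_aug_lift z (r \<odot>\<^bsub>free_module ?R B\<^esub> x) g"
  proof -
    have "{b. (r \<odot>\<^bsub>free_module ?R B\<^esub> x) b \<noteq> (\<lambda>g. 0)} \<subseteq> ?S"
      using R.r_null[OF r] by (auto simp: free_module_simps monoid_ring_simps)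
    from free_aug_lift_superset[OF S this] show ?thesis by (simp add: free_module_simps)
  qed
  finally show "free_aug_lift z (r \<odot>\<^bsub>free_module ?R B\<^esub> x) g = (r \<otimes>\<^bsub>?R\<^esub> free_aug_lift z x) g" by simp
qed

lemma aug_free_aug_lift:
  assumes x: "x \<in> carrier (free_module (monoid_ring M) B)"
    and S: "finite S" "{b. x b \<noteq> (\<lambda>g. 0)} \<subseteq> S"
  shows "aug (free_aug_lift z x) = (\<Sum>b\<in>S. aug (x b) * z b)"
proof -
  have xb: "x b \<in> carrier (monoid_ring M)" for b
    using free_module_carrierD[OF x] by auto
  define C where "C = (\<Union>b\<in>S. {g. x b g \<noteq> 0})"
  have C: "finite C" unfolding C_def using S(1) monoid_ring_carrierD(1)[OF xb] by blast
  have lC: "{h. free_aug_lift z x h \<noteq> 0} \<subseteq> C"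
  proof
    fix h assume "h \<in> {h. free_aug_lift z x h \<noteq> 0}"
    then have "(\<Sum>b\<in>S. x b h * z b) \<noteq> 0" by (simp add: free_aug_lift_superset[OF S])
    then obtain b where "b \<in> S" "x b h * z b \<noteq> 0" by (rule sum.not_neutral_contains_not_neutral)
    then show "h \<in> C" by (auto simp: C_def)
  qed
  have "aug (free_aug_lift z x) = (\<Sum>h\<in>C. \<Sum>b\<in>S. x b h * z b)"
    by (simp add: aug_superset[OF C lC] free_aug_lift_superset[OF S])
  also have "\<dots> = (\<Sum>b\<in>S. (\<Sum>h\<in>C. x b h) * z b)"
    by (subst sum.swap) (simp add: sum_distrib_right)
  also have "\<dots> = (\<Sum>b\<in>S. aug (x b) * z b)"
    by (intro sum.cong HOL.refl, subst aug_superset[OF C]) (auto simp: C_def)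
  finally show ?thesis .
qed

lemma free_module_hom_expand:
  fixes M :: "('g, 'x) monoid_scheme" and B :: "'b set" and \<theta> :: "('b \<Rightarrow> 'g \<Rightarrow> int) \<Rightarrow> int"
  assumes M: "Group.monoid M"
    and \<theta>: "\<theta> \<in> module_hom (monoid_ring M) (free_module (monoid_ring M) B) trivial_module"
    and "finite S" "S \<subseteq> B" "x \<in> carrier (free_module (monoid_ring M) B)" "{b. x b \<noteq> (\<lambda>g. 0)} \<subseteq> S"
  shows "\<theta> x = (\<Sum>b\<in>S. aug (x b) * \<theta> (\<lambda>c. if c = b then \<one>\<^bsub>monoid_ring M\<^esub> else \<zero>\<^bsub>monoid_ring M\<^esub>))"
  using assms(3-)
proof (induction S arbitrary: x)
  case empty
  then have "x = \<zero>\<^bsub>free_module (monoid_ring M) B\<^esub>"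
    by (auto simp: free_module_simps monoid_ring_simps fun_eq_iff)
  then show ?case
    using module_hom_zero[OF left_module_free_module[OF ring_monoid_ring[OF M]] left_module_trivial_module[OF M] \<theta>]
    by (simp add: trivial_module_simps)
next
  case (insert b S)
  let ?R = "monoid_ring M"
  let ?F = "free_module ?R B"
  let ?e = "\<lambda>b c. if c = b then \<one>\<^bsub>?R\<^esub> else \<zero>\<^bsub>?R\<^esub>"
  interpret R: ring ?R by (rule ring_monoid_ring[OF M])
  interpret F: left_module ?R ?F by (rule left_module_free_module[OF R.ring_axioms])
  have xb: "x c \<in> carrier ?R" for c using insert.prems(2) by (rule free_module_carrierD)
  define y where "y = x(b := \<zero>\<^bsub>?R\<^esub>)"
  have e: "?e b \<in> carrier ?F" using insert.prems(1) by (auto simp: free_module_def)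
  have y: "y \<in> carrier ?F"
    using insert.prems(2) by (auto simp: free_module_def y_def elim: rev_finite_subset)
  have s: "{c. y c \<noteq> (\<lambda>g. 0)} \<subseteq> S" using insert.prems(3) by (auto simp: y_def monoid_ring_simps)
  have "x = y \<oplus>\<^bsub>?F\<^esub> (x b \<odot>\<^bsub>?F\<^esub> ?e b)"
    using xb by (auto simp: free_module_simps y_def fun_eq_iff[of x])
  then have "\<theta> x = \<theta> (y \<oplus>\<^bsub>?F\<^esub> (x b \<odot>\<^bsub>?F\<^esub> ?e b))" by (rule arg_cong)
  also have "\<dots> = \<theta> y + aug (x b) * \<theta> (?e b)"
    using module_hom_add[OF \<theta> y F.smult_closed[OF xb e]] module_hom_smult[OF \<theta> xb e]
    by (simp only: trivial_module_simps)
  finally have "\<theta> x = \<theta> y + aug (x b) * \<theta> (?e b)" .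
  moreover have "\<theta> y = (\<Sum>c\<in>S. aug (x c) * \<theta> (?e c))"
  proof -
    have "y c = x c" if "c \<in> S" for c using that insert.hyps(2) by (auto simp: y_def)
    then show ?thesis using insert.IH[OF _ y s] insert.prems(1) by simp
  qed
  ultimately show ?case unfolding sum.insert[OF insert.hyps] by (simp only: add.commute)
qed

text \<open>
  Freeness: a map to the trivial module lifts through the augmentation, because the image of each
  basis element does. The lift is the \<open>free_aug_lift\<close> with the values of \<open>\<theta>\<close> on the basis.
\<close>

lemma lift_along_aug:
  fixes M :: "('g, 'x) monoid_scheme" and B :: "'b set"
  assumes M: "Group.monoid M"
    and \<theta>: "\<theta> \<in> module_hom (monoid_ring M) (free_module (monoid_ring M) B) trivial_module"
  obtains F where
    "\<And>x. x \<in> carrier (free_module (monoid_ring M) B) \<Longrightarrow> F x \<in> carrier (monoid_ring M)"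
    "\<And>x y. x \<in> carrier (free_module (monoid_ring M) B) \<Longrightarrow> y \<in> carrier (free_module (monoid_ring M) B)
      \<Longrightarrow> F (x \<oplus>\<^bsub>free_module (monoid_ring M) B\<^esub> y) = F x \<oplus>\<^bsub>monoid_ring M\<^esub> F y"
    "\<And>r x. r \<in> carrier (monoid_ring M) \<Longrightarrow> x \<in> carrier (free_module (monoid_ring M) B)
      \<Longrightarrow> F (r \<odot>\<^bsub>free_module (monoid_ring M) B\<^esub> x) = r \<otimes>\<^bsub>monoid_ring M\<^esub> F x"
    "\<And>x. x \<in> carrier (free_module (monoid_ring M) B) \<Longrightarrow> aug (F x) = \<theta> x"
proof
  let ?z = "\<lambda>b. \<theta> (\<lambda>c. if c = b then \<one>\<^bsub>monoid_ring M\<^esub> else \<zero>\<^bsub>monoid_ring M\<^esub>)"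
  fix x assume x: "x \<in> carrier (free_module (monoid_ring M) B)"
  have s: "finite {b. x b \<noteq> (\<lambda>g. 0)}" "{b. x b \<noteq> (\<lambda>g. 0)} \<subseteq> B"
    using free_module_carrierD(1,2)[OF x] by (simp_all add: monoid_ring_simps)
  show "free_aug_lift ?z x \<in> carrier (monoid_ring M)" using x by (rule free_aug_lift_closed)
  show "aug (free_aug_lift ?z x) = \<theta> x"
    using aug_free_aug_lift[OF x s(1) subset_refl, of ?z]
      free_module_hom_expand[OF M \<theta> s x subset_refl] by simp
qed (rule free_aug_lift_add free_aug_lift_smult[OF M]; assumption)+

definition augmentation_ideal :: "('g, 'x) monoid_scheme \<Rightarrow> ('g \<Rightarrow> int) set" where
  "augmentation_ideal M = {f \<in> carrier (monoid_ring M). aug f = 0}"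

definition left_ideal :: "('r, 'x) ring_scheme \<Rightarrow> 'r set \<Rightarrow> bool" where
  "left_ideal R N \<longleftrightarrow> N \<subseteq> carrier R \<and> \<zero>\<^bsub>R\<^esub> \<in> N \<and> (\<forall>a\<in>N. \<forall>b\<in>N. a \<oplus>\<^bsub>R\<^esub> b \<in> N)
    \<and> (\<forall>r\<in>carrier R. \<forall>a\<in>N. r \<otimes>\<^bsub>R\<^esub> a \<in> N)"

text \<open>
  Schanuel's lemma for the two presentations of the trivial module by \<open>P 0\<close> and by the ring
  itself. Projectivity of \<open>P 0\<close> gives \<open>\<phi> : P 0 \<rightarrow> R\<close> over the augmentation; for \<open>e\<close> in \<open>P 0\<close> over \<open>1\<close>
  and \<open>f\<close> in the augmentation ideal, \<open>f = \<phi>(f e) + f (1 - \<phi>(e))\<close>, where \<open>f e\<close> lies in the finitely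
  generated kernel of \<open>\<epsilon>\<close>. Generation is phrased by left ideals, which avoids finite sums over
  the ring in the applications.
\<close>

lemma FP_module_1_augmentation_ideal_fg:
  fixes M :: "('g, 'x) monoid_scheme"
  assumes M: "Group.monoid M"
    and FP: "FP_module TYPE('m) 1 (monoid_ring M) trivial_module"
  obtains A where "finite A" "A \<subseteq> augmentation_ideal M"
    "\<forall>N. left_ideal (monoid_ring M) N \<longrightarrow> A \<subseteq> N \<longrightarrow> augmentation_ideal M \<subseteq> N"
proof -
  let ?R = "monoid_ring M"
  let ?Z = "trivial_module :: ('g \<Rightarrow> int, int) module"
  interpret R: ring ?R by (rule ring_monoid_ring[OF M])
  interpret Z: left_module ?R ?Z by (rule left_module_trivial_module[OF M])
  obtain P :: "nat \<Rightarrow> ('g \<Rightarrow> int, 'm) module" and d \<epsilon> where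
    res: "projective_resolution ?R ?Z P d \<epsilon>" and fg: "\<forall>i\<le>1. fin_gen_module ?R (P i)"
    using FP by (auto simp: FP_module_def)
  have \<epsilon>: "\<epsilon> \<in> module_hom ?R (P 0) ?Z" and \<epsilon>_surj: "\<epsilon> ` carrier (P 0) = UNIV"
    and d: "d 0 \<in> module_hom ?R (P 1) (P 0)" and ker: "d 0 ` carrier (P 1) = a_kernel (P 0) ?Z \<epsilon>"
    and proj: "projective_module ?R (P 0)" and lm: "left_module ?R (P 0)" "left_module ?R (P 1)"
    using res by (auto simp: projective_resolution_def projective_module_def trivial_module_simps)
  interpret P0: left_module ?R "P 0" by fact
  interpret P1: left_module ?R "P 1" by fact
  obtain B :: "'m set" and \<iota> \<pi> where \<iota>: "\<iota> \<in> module_hom ?R (P 0) (free_module ?R B)"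
    and \<pi>: "\<pi> \<in> module_hom ?R (free_module ?R B) (P 0)" and split: "\<And>x. x \<in> carrier (P 0) \<Longrightarrow> \<pi> (\<iota> x) = x"
    using proj by (auto simp: projective_module_def)
  interpret F: left_module ?R "free_module ?R B" by (rule left_module_free_module[OF R.ring_axioms])
  have "(\<lambda>x. \<epsilon> (\<pi> x)) \<in> module_hom ?R (free_module ?R B) ?Z"
    using module_hom_add[OF \<pi>] module_hom_add[OF \<epsilon>] module_hom_smult[OF \<pi>] module_hom_smult[OF \<epsilon>]
      module_hom_closed[OF \<pi>] module_hom_closed[OF \<epsilon>]
    by (auto simp: module_hom_def hom_def)
  from lift_along_aug[OF M this] obtain F where F: "\<And>x. x \<in> carrier (free_module ?R B) \<Longrightarrow> F x \<in> carrier ?R"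
    "\<And>x y. x \<in> carrier (free_module ?R B) \<Longrightarrow> y \<in> carrier (free_module ?R B)
      \<Longrightarrow> F (x \<oplus>\<^bsub>free_module ?R B\<^esub> y) = F x \<oplus>\<^bsub>?R\<^esub> F y"
    "\<And>r x. r \<in> carrier ?R \<Longrightarrow> x \<in> carrier (free_module ?R B)
      \<Longrightarrow> F (r \<odot>\<^bsub>free_module ?R B\<^esub> x) = r \<otimes>\<^bsub>?R\<^esub> F x"
    "\<And>x. x \<in> carrier (free_module ?R B) \<Longrightarrow> aug (F x) = \<epsilon> (\<pi> x)"
    by blast
  define \<phi> where "\<phi> y = F (\<iota> y)" for y
  have \<phi>: "\<And>y. y \<in> carrier (P 0) \<Longrightarrow> \<phi> y \<in> carrier ?R"
    "\<And>y y'. y \<in> carrier (P 0) \<Longrightarrow> y' \<in> carrier (P 0) \<Longrightarrow> \<phi> (y \<oplus>\<^bsub>P 0\<^esub> y') = \<phi> y \<oplus>\<^bsub>?R\<^esub> \<phi> y'"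
    "\<And>r y. r \<in> carrier ?R \<Longrightarrow> y \<in> carrier (P 0) \<Longrightarrow> \<phi> (r \<odot>\<^bsub>P 0\<^esub> y) = r \<otimes>\<^bsub>?R\<^esub> \<phi> y"
    "\<And>y. y \<in> carrier (P 0) \<Longrightarrow> aug (\<phi> y) = \<epsilon> y"
    using F module_hom_closed[OF \<iota>] module_hom_add[OF \<iota>] module_hom_smult[OF \<iota>]
    by (simp_all add: \<phi>_def split)
  obtain A1 where A1: "finite A1" "A1 \<subseteq> carrier (P 1)"
    and gen: "\<forall>x\<in>carrier (P 1). \<exists>c\<in>A1 \<rightarrow> carrier ?R. x = (\<Oplus>\<^bsub>P 1\<^esub>a\<in>A1. c a \<odot>\<^bsub>P 1\<^esub> a)"
    using fg by (auto simp: fin_gen_module_def)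
  obtain e where e: "e \<in> carrier (P 0)" "\<epsilon> e = 1" using \<epsilon>_surj by (metis UNIV_I imageE)
  have d0: "d 0 a \<in> carrier (P 0)" "\<epsilon> (d 0 a) = 0" if "a \<in> carrier (P 1)" for a
    using ker that by (auto simp: a_kernel_def kernel_def trivial_module_def)
  have aug_add: "aug (f \<oplus>\<^bsub>?R\<^esub> h) = aug f + aug h" if "f \<in> carrier ?R" "h \<in> carrier ?R" for f h
    using Z.smult_l_distr[of f h 1] that by (simp add: trivial_module_simps)
  have aug_one: "aug \<one>\<^bsub>?R\<^esub> = 1" using Z.smult_one[of 1] by (simp add: trivial_module_simps)
  have aug_diff: "aug (f \<ominus>\<^bsub>?R\<^esub> h) = aug f - aug h" if "f \<in> carrier ?R" "h \<in> carrier ?R" for f h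
  proof -
    have "(f \<ominus>\<^bsub>?R\<^esub> h) \<oplus>\<^bsub>?R\<^esub> h = f" using that by algebra
    then show ?thesis using aug_add[of "f \<ominus>\<^bsub>?R\<^esub> h" h] that by simp
  qed
  define A where "A = insert (\<one>\<^bsub>?R\<^esub> \<ominus>\<^bsub>?R\<^esub> \<phi> e) ((\<lambda>a. \<phi> (d 0 a)) ` A1)"
  show ?thesis
  proof (rule that)
    show "finite A" using A1 by (simp add: A_def)
    show "A \<subseteq> augmentation_ideal M"
      using A1 d0 \<phi> e by (auto simp: A_def augmentation_ideal_def aug_diff aug_one)
  next
    show "\<forall>N. left_ideal ?R N \<longrightarrow> A \<subseteq> N \<longrightarrow> augmentation_ideal M \<subseteq> N"
    proof (intro allI impI subsetI)
      fix N f
      assume N: "left_ideal ?R N" and AN: "A \<subseteq> N" and "f \<in> augmentation_ideal M"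
      then have f: "f \<in> carrier ?R" "aug f = 0" by (auto simp: augmentation_ideal_def)
      have N0: "\<zero>\<^bsub>?R\<^esub> \<in> N"
        and Nadd: "\<And>a b. a \<in> N \<Longrightarrow> b \<in> N \<Longrightarrow> a \<oplus>\<^bsub>?R\<^esub> b \<in> N"
        and Nmul: "\<And>r a. r \<in> carrier ?R \<Longrightarrow> a \<in> N \<Longrightarrow> r \<otimes>\<^bsub>?R\<^esub> a \<in> N"
        using N by (auto simp: left_ideal_def)
      have zero: "\<phi> (d 0 \<zero>\<^bsub>P 1\<^esub>) = \<zero>\<^bsub>?R\<^esub>"
      proof -
        have "\<phi> \<zero>\<^bsub>P 0\<^esub> = \<phi> \<zero>\<^bsub>P 0\<^esub> \<oplus>\<^bsub>?R\<^esub> \<phi> \<zero>\<^bsub>P 0\<^esub>" using \<phi>(2)[of "\<zero>\<^bsub>P 0\<^esub>" "\<zero>\<^bsub>P 0\<^esub>"] by simp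
        then have "\<phi> \<zero>\<^bsub>P 0\<^esub> = \<zero>\<^bsub>?R\<^esub>" using \<phi>(1)[of "\<zero>\<^bsub>P 0\<^esub>"] by (metis P0.M.zero_closed R.add.r_cancel_one')
        then show ?thesis using module_hom_zero[OF lm(2,1) d] by simp
      qed
      have span: "\<phi> (d 0 (\<Oplus>\<^bsub>P 1\<^esub>a\<in>A'. c a \<odot>\<^bsub>P 1\<^esub> a)) \<in> N" if "A' \<subseteq> A1" "c \<in> A1 \<rightarrow> carrier ?R" for A' c
        using finite_subset[OF that(1) A1(1)] that(1)
      proof (induction A')
        case empty
        then show ?case using zero N0 by (simp only: P1.M.finsum_empty)
      next
        case (insert a A')
        have car: "(\<lambda>a. c a \<odot>\<^bsub>P 1\<^esub> a) \<in> A' \<rightarrow> carrier (P 1)" "c a \<in> carrier ?R" "a \<in> carrier (P 1)"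
          using insert.prems that(2) A1(2) by (auto intro!: P1.smult_closed simp del: One_nat_def)
        have car2: "c a \<odot>\<^bsub>P 1\<^esub> a \<in> carrier (P 1)" "(\<Oplus>\<^bsub>P 1\<^esub>a\<in>A'. c a \<odot>\<^bsub>P 1\<^esub> a) \<in> carrier (P 1)"
          using car by (auto intro: P1.smult_closed P1.M.finsum_closed simp del: One_nat_def)
        have "(\<Oplus>\<^bsub>P 1\<^esub>a\<in>insert a A'. c a \<odot>\<^bsub>P 1\<^esub> a) = c a \<odot>\<^bsub>P 1\<^esub> a \<oplus>\<^bsub>P 1\<^esub> (\<Oplus>\<^bsub>P 1\<^esub>a\<in>A'. c a \<odot>\<^bsub>P 1\<^esub> a)"
          using insert.hyps car(1) car2(1) by (intro P1.M.finsum_insert) auto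
        then have "\<phi> (d 0 (\<Oplus>\<^bsub>P 1\<^esub>a\<in>insert a A'. c a \<odot>\<^bsub>P 1\<^esub> a))
          = c a \<otimes>\<^bsub>?R\<^esub> \<phi> (d 0 a) \<oplus>\<^bsub>?R\<^esub> \<phi> (d 0 (\<Oplus>\<^bsub>P 1\<^esub>a\<in>A'. c a \<odot>\<^bsub>P 1\<^esub> a))"
          using module_hom_add[OF d car2] module_hom_smult[OF d car(2,3)]
            \<phi>(2)[OF P0.smult_closed[OF car(2) d0(1)[OF car(3)]] d0(1)[OF car2(2)]]
            \<phi>(3)[OF car(2) d0(1)[OF car(3)]] by simp
        moreover have "\<phi> (d 0 a) \<in> N" using AN insert.prems by (auto simp: A_def)
        ultimately show ?case using insert.IH insert.prems Nadd Nmul car(2) by simp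
      qed
      have "\<epsilon> (f \<odot>\<^bsub>P 0\<^esub> e) = 0" using module_hom_smult[OF \<epsilon> f(1) e(1)] f(2) by (simp add: trivial_module_simps)
      then have "f \<odot>\<^bsub>P 0\<^esub> e \<in> d 0 ` carrier (P 1)"
        unfolding ker using P0.smult_closed[OF f(1) e(1)] by (simp add: a_kernel_def kernel_def trivial_module_def)
      then obtain y where y: "y \<in> carrier (P 1)" "f \<odot>\<^bsub>P 0\<^esub> e = d 0 y" by auto
      obtain c where "c \<in> A1 \<rightarrow> carrier ?R" "y = (\<Oplus>\<^bsub>P 1\<^esub>a\<in>A1. c a \<odot>\<^bsub>P 1\<^esub> a)" using gen y(1) by auto
      then have "\<phi> (f \<odot>\<^bsub>P 0\<^esub> e) \<in> N" using span[of A1 c] y(2) by simp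
      then have "f \<otimes>\<^bsub>?R\<^esub> \<phi> e \<in> N" using \<phi>(3)[OF f(1) e(1)] by simp
      moreover have "f \<otimes>\<^bsub>?R\<^esub> (\<one>\<^bsub>?R\<^esub> \<ominus>\<^bsub>?R\<^esub> \<phi> e) \<in> N" using AN f(1) by (auto simp: A_def intro: Nmul)
      moreover have "f = f \<otimes>\<^bsub>?R\<^esub> \<phi> e \<oplus>\<^bsub>?R\<^esub> f \<otimes>\<^bsub>?R\<^esub> (\<one>\<^bsub>?R\<^esub> \<ominus>\<^bsub>?R\<^esub> \<phi> e)"
        using f(1) \<phi>(1)[OF e(1)] by (simp add: R.r_distr R.minus_eq R.r_minus R.a_lcomm[of _ f] R.r_neg)
      ultimately show "f \<in> N" using Nadd by metis
    qed
  qed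
qed


section \<open>A criterion for lying outside the first Sigma invariant\<close>

text \<open>
  The derivation \<open>D\<close> extends to an additive map \<open>\<Phi>\<close> on the monoid ring, and on the augmentation ideal
  \<open>\<Phi>\<close> is linear over the ring, since the terms \<open>D g y\<close> of the derivation rule carry the factor
  \<open>aug f = 0\<close>. Hence the elements \<open>f\<close> for which \<open>\<Phi> f\<close> vanishes above a fixed height form a left ideal.
  With a height valid for the finitely many generators, this left ideal is everything, although
  it misses some \<open>g - 1\<close>, where \<open>\<Phi>\<close> takes the value \<open>D g\<close>.
\<close>

theorem Sigma1_complement_criterion:
  fixes G :: "('g, 'x) monoid_scheme" and \<chi> :: "'g \<Rightarrow> real" and p :: int
    and act :: "'g \<Rightarrow> 'y \<Rightarrow> 'y" and D :: "'g \<Rightarrow> 'y \<Rightarrow> int" and ht :: "'y \<Rightarrow> real"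
  assumes G: "group G" and \<chi>: "\<chi> \<in> nonzero_chars G"
    and deriv: "\<And>g h y. g \<in> carrier G \<Longrightarrow> h \<in> carrier G
      \<Longrightarrow> [D (g \<otimes>\<^bsub>G\<^esub> h) y = D g y + D h (act g y)] (mod p)"
    and ht: "\<And>g y. g \<in> carrier G \<Longrightarrow> ht (act g y) = ht y + \<chi> g"
    and bdd: "\<And>g. g \<in> carrier G \<Longrightarrow> \<exists>b. \<forall>y. ht y > b \<longrightarrow> p dvd D g y"
    and unbdd: "\<And>b. \<exists>g\<in>carrier G. \<chi> g \<ge> 0 \<and> (\<exists>y. ht y > b \<and> \<not> p dvd D g y)"
  shows "char_class G \<chi> \<in> char_sphere G - Sigma1 TYPE('m) G"
proof
  show "char_class G \<chi> \<in> char_sphere G"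
    unfolding char_class_def char_sphere_def by (rule quotientI[OF \<chi>])
  show "char_class G \<chi> \<notin> Sigma1 TYPE('m) G"
  proof
    assume "char_class G \<chi> \<in> Sigma1 TYPE('m) G"
    then obtain \<psi> where eq: "char_class G \<chi> = char_class G \<psi>" and \<psi>: "\<psi> \<in> nonzero_chars G"
      and FP\<psi>: "FP_module TYPE('m) 1 (monoid_ring (nonneg_monoid G \<psi>)) trivial_module"
      by (auto simp: Sigma1_def)
    have "(\<psi>, \<psi>) \<in> char_rel G" using \<psi> by (auto simp: char_rel_def intro!: exI[of _ 1])
    then have "(\<chi>, \<psi>) \<in> char_rel G" using eq by (auto simp: char_class_def)
    then obtain r where r: "r > 0" "\<And>g. g \<in> carrier G \<Longrightarrow> \<chi> g = r * \<psi> g" unfolding char_rel_def by blast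
    have "\<chi> g \<ge> 0 \<longleftrightarrow> \<psi> g \<ge> 0" if "g \<in> carrier G" for g
      unfolding r(2)[OF that] using r(1) by (simp add: zero_le_mult_iff)
    then have "{g \<in> carrier G. \<psi> g \<ge> 0} = {g \<in> carrier G. \<chi> g \<ge> 0}" by blast
    \<comment> \<open>Membership in the invariant depends on the class only, so \<open>\<chi>\<close> itself may be used as representative.\<close>
    then have "nonneg_monoid G \<psi> = nonneg_monoid G \<chi>" by (simp add: nonneg_monoid_def)
    then have FP: "FP_module TYPE('m) 1 (monoid_ring (nonneg_monoid G \<chi>)) trivial_module"
      using FP\<psi> by simp
    let ?M = "nonneg_monoid G \<chi>" and ?R = "monoid_ring (nonneg_monoid G \<chi>)"
    interpret G: group G by (rule G)
    have hom: "\<chi> \<in> hom G real_group" using \<chi> by (simp add: nonzero_chars_def)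
    have M: "Group.monoid ?M" by (rule monoid_nonneg_monoid[OF G hom])
    interpret R: ring ?R by (rule ring_monoid_ring[OF M])
    have Mc: "g \<in> carrier ?M \<longleftrightarrow> g \<in> carrier G \<and> \<chi> g \<ge> 0" for g by (simp add: nonneg_monoid_def)
    have Mm: "g \<otimes>\<^bsub>?M\<^esub> h = g \<otimes>\<^bsub>G\<^esub> h" for g h by (simp add: nonneg_monoid_def)
    have M1: "\<one>\<^bsub>?M\<^esub> = \<one>\<^bsub>G\<^esub>" by (simp add: nonneg_monoid_def)
    define \<Phi> where "\<Phi> f y = (\<Sum>g | f g \<noteq> 0. f g * D g y)" for f y
    have \<Phi>_superset: "\<Phi> f y = (\<Sum>g\<in>A. f g * D g y)" if "finite A" "{g. f g \<noteq> 0} \<subseteq> A" for f y A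
      unfolding \<Phi>_def by (rule sum.mono_neutral_left) (use that in auto)
    obtain A where A: "finite A" "A \<subseteq> augmentation_ideal ?M"
      and gen: "\<forall>N. left_ideal ?R N \<longrightarrow> A \<subseteq> N \<longrightarrow> augmentation_ideal ?M \<subseteq> N"
      using FP_module_1_augmentation_ideal_fg[OF M FP] .
    have Ac: "f \<in> carrier ?R" "aug f = 0" if "f \<in> A" for f
      using A(2) that by (auto simp: augmentation_ideal_def)
    obtain bnd where bnd: "\<And>g y. g \<in> carrier G \<Longrightarrow> ht y > bnd g \<Longrightarrow> p dvd D g y"
      using bdd by metis
    define b where "b = Max (insert 0 (bnd ` (\<Union>f\<in>A. {g. f g \<noteq> 0})))"
    have "finite (\<Union>f\<in>A. {g. f g \<noteq> 0})"
      using A(1) monoid_ring_carrierD(1)[OF Ac(1)] by blast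
    then have b: "bnd g \<le> b" if "f \<in> A" "f g \<noteq> 0" for f g
      unfolding b_def using that by (intro Max_ge) auto
    \<comment> \<open>The left ideal; \<open>b\<close> is a height above which the derivation vanishes on all group elements that occur in the generators.\<close>
    define N where "N = {f \<in> carrier ?R. aug f = 0 \<and> (\<forall>y. ht y > b \<longrightarrow> p dvd \<Phi> f y)}"
    have Z: "left_module ?R (trivial_module :: ('g \<Rightarrow> int, int) module)"
      by (rule left_module_trivial_module[OF M])
    have aug_add: "aug (f \<oplus>\<^bsub>?R\<^esub> h) = aug f + aug h" if "f \<in> carrier ?R" "h \<in> carrier ?R" for f h
      using left_module.smult_l_distr[OF Z that, of 1] by (simp add: trivial_module_simps)
    have aug_mult: "aug (f \<otimes>\<^bsub>?R\<^esub> h) = aug f * aug h" if "f \<in> carrier ?R" "h \<in> carrier ?R" for f h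
      using left_module.smult_assoc[OF Z that, of 1] by (simp add: trivial_module_simps)
    have "A \<subseteq> N"
    proof
      fix f assume f: "f \<in> A"
      then have fc: "f \<in> carrier ?R" "aug f = 0" by (rule Ac)+
      have "p dvd \<Phi> f y" if "ht y > b" for y
        unfolding \<Phi>_def
      proof (rule dvd_sum)
        fix g assume "g \<in> {g. f g \<noteq> 0}"
        then have "g \<in> carrier G" "bnd g < ht y"
          using monoid_ring_carrierD(2)[OF fc(1)] b[OF f] that by (auto simp: Mc intro: le_less_trans)
        then show "p dvd f g * D g y" using bnd by (intro dvd_mult) auto
      qed
      then show "f \<in> N" using fc by (simp add: N_def)
    qed
    moreover have "\<zero>\<^bsub>?R\<^esub> \<in> N"
      using R.zero_closed by (simp add: N_def \<Phi>_def aug_def monoid_ring_simps)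
    moreover have "N \<subseteq> carrier ?R" by (auto simp: N_def)
    moreover have "f \<oplus>\<^bsub>?R\<^esub> h \<in> N" if "f \<in> N" "h \<in> N" for f h
    proof -
      have c: "f \<in> carrier ?R" "h \<in> carrier ?R" using that by (auto simp: N_def)
      let ?S = "{g. f g \<noteq> 0} \<union> {g. h g \<noteq> 0}"
      have S: "finite ?S" using c[THEN monoid_ring_carrierD(1)] by simp
      have "\<Phi> (f \<oplus>\<^bsub>?R\<^esub> h) y = \<Phi> f y + \<Phi> h y" for y
        by (subst (1 2 3) \<Phi>_superset[OF S]) (auto simp: monoid_ring_simps sum.distrib distrib_right)
      then show ?thesis using that c by (simp add: N_def aug_add)
    qed
    moreover have "r \<otimes>\<^bsub>?R\<^esub> f \<in> N" if r: "r \<in> carrier ?R" and f: "f \<in> N" for r f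
    proof -
      have fc: "f \<in> carrier ?R" "aug f = 0" and fb: "\<And>y. ht y > b \<Longrightarrow> p dvd \<Phi> f y"
        using f by (auto simp: N_def)
      let ?A = "{x. r x \<noteq> 0}" and ?B = "{x. f x \<noteq> 0}"
      have "p dvd \<Phi> (r \<otimes>\<^bsub>?R\<^esub> f) y" if y: "ht y > b" for y
      proof -
        have "\<Phi> (r \<otimes>\<^bsub>?R\<^esub> f) y = (\<Sum>g\<in>?A. \<Sum>h\<in>?B. r g * f h * D (g \<otimes>\<^bsub>G\<^esub> h) y)"
          using monoid_ring_pair[OF M r fc(1), of "\<lambda>g. D g y"] by (simp add: \<Phi>_def Mm)
        moreover have "[\<dots> = (\<Sum>g\<in>?A. \<Sum>h\<in>?B. r g * f h * (D g y + D h (act g y)))] (mod p)"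
          by (intro cong_sum cong_mult cong_refl deriv)
            (use monoid_ring_carrierD(2)[OF r] monoid_ring_carrierD(2)[OF fc(1)] in \<open>auto simp: Mc\<close>)
        moreover have "(\<Sum>g\<in>?A. \<Sum>h\<in>?B. r g * f h * (D g y + D h (act g y)))
          = (\<Sum>g\<in>?A. r g * D g y * aug f) + (\<Sum>g\<in>?A. r g * \<Phi> f (act g y))"
          by (simp add: \<Phi>_def aug_def sum_distrib_left sum.distrib distrib_left mult_ac)
        moreover have "p dvd (\<Sum>g\<in>?A. r g * \<Phi> f (act g y))"
        proof (rule dvd_sum)
          fix g assume "g \<in> ?A"
          then have "g \<in> carrier G" "\<chi> g \<ge> 0" using monoid_ring_carrierD(2)[OF r] by (auto simp: Mc)
          then have "ht (act g y) > b" using y ht[of g y] by simp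
          then show "p dvd r g * \<Phi> f (act g y)" using fb by simp
        qed
        ultimately show ?thesis using fc(2) by (simp add: cong_dvd_iff)
      qed
      then show ?thesis using r fc by (simp add: N_def aug_mult)
    qed
    ultimately have "left_ideal ?R N" "A \<subseteq> N" by (simp_all only: left_ideal_def) simp_all
    then have "augmentation_ideal ?M \<subseteq> N" using gen by simp
    then have N: "f \<in> N" if "f \<in> carrier ?R" "aug f = 0" for f
      using that unfolding augmentation_ideal_def by blast
    obtain g y where g: "g \<in> carrier G" "\<chi> g \<ge> 0" and y: "ht y > max b (bnd \<one>\<^bsub>G\<^esub>)" "\<not> p dvd D g y"
      using unbdd[of "max b (bnd \<one>\<^bsub>G\<^esub>)"] by (elim bexE conjE exE)
    \<comment> \<open>The element \<open>g - 1\<close> of the augmentation ideal, written as a function.\<close>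
    let ?f = "\<lambda>h. (if h = g then 1 else 0) - (if h = \<one>\<^bsub>G\<^esub> then 1 else (0::int))"
    have s: "{h. ?f h \<noteq> 0} \<subseteq> {g, \<one>\<^bsub>G\<^esub>}" by auto
    have ne: "g \<noteq> \<one>\<^bsub>G\<^esub>" using bnd[of "\<one>\<^bsub>G\<^esub>" y] y by auto
    have "\<one>\<^bsub>G\<^esub> \<in> carrier ?M" using monoid.one_closed[OF M] by (simp add: M1)
    then have "?f \<in> carrier ?R"
      using g finite_subset[OF s] by (auto simp: monoid_ring_def Mc)
    moreover have "aug ?f = 0" using ne by (subst aug_superset[OF _ s]) auto
    ultimately have "?f \<in> N" by (rule N)
    then have "p dvd \<Phi> ?f y" using y by (simp add: N_def)
    moreover have "\<Phi> ?f y = D g y - D \<one>\<^bsub>G\<^esub> y" using ne by (subst \<Phi>_superset[OF _ s]) auto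
    moreover have "p dvd D \<one>\<^bsub>G\<^esub> y" using bnd y by simp
    ultimately have "p dvd (D g y - D \<one>\<^bsub>G\<^esub> y) + D \<one>\<^bsub>G\<^esub> y" by (intro dvd_add) simp_all
    then show False using y(2) by simp
  qed
qed

section \<open>Weighted walks\<close>

text \<open>
  A generator \<open>s\<close> leads from \<open>(j, x)\<close> to \<open>(j + \<eta> s, x + \<epsilon> s j)\<close> along an edge of weight \<open>d s j x\<close>; an
  inverse letter traverses the edge that ends at \<open>(j, x)\<close> backwards. This is a right action of the
  free group on \<open>\<int> \<times> \<int>\<close>, with \<open>weight\<close> as a cocycle. Keeping \<open>height\<close> and \<open>shift\<close> apart is possible
  because neither depends on \<open>x\<close>.
\<close>

definition letter_height :: "('v \<Rightarrow> int) \<Rightarrow> 'v \<times> bool \<Rightarrow> int" where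
  "letter_height \<eta> a = (if snd a then \<eta> (fst a) else - \<eta> (fst a))"

definition letter_shift :: "('v \<Rightarrow> int) \<Rightarrow> ('v \<Rightarrow> int \<Rightarrow> int) \<Rightarrow> 'v \<times> bool \<Rightarrow> int \<Rightarrow> int" where
  "letter_shift \<eta> \<epsilon> a j = (if snd a then \<epsilon> (fst a) j else - \<epsilon> (fst a) (j - \<eta> (fst a)))"

definition letter_weight :: "('v \<Rightarrow> int) \<Rightarrow> ('v \<Rightarrow> int \<Rightarrow> int) \<Rightarrow> ('v \<Rightarrow> int \<Rightarrow> int \<Rightarrow> int)
    \<Rightarrow> 'v \<times> bool \<Rightarrow> int \<Rightarrow> int \<Rightarrow> int" where
  "letter_weight \<eta> \<epsilon> d a j x = (if snd a then d (fst a) j x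
    else - d (fst a) (j - \<eta> (fst a)) (x - \<epsilon> (fst a) (j - \<eta> (fst a))))"

primrec height :: "('v \<Rightarrow> int) \<Rightarrow> 'v word \<Rightarrow> int" where
  "height \<eta> [] = 0"
| "height \<eta> (a # w) = letter_height \<eta> a + height \<eta> w"

primrec shift :: "('v \<Rightarrow> int) \<Rightarrow> ('v \<Rightarrow> int \<Rightarrow> int) \<Rightarrow> 'v word \<Rightarrow> int \<Rightarrow> int" where
  "shift \<eta> \<epsilon> [] j = 0"
| "shift \<eta> \<epsilon> (a # w) j = letter_shift \<eta> \<epsilon> a j + shift \<eta> \<epsilon> w (j + letter_height \<eta> a)"

primrec weight :: "('v \<Rightarrow> int) \<Rightarrow> ('v \<Rightarrow> int \<Rightarrow> int) \<Rightarrow> ('v \<Rightarrow> int \<Rightarrow> int \<Rightarrow> int)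
    \<Rightarrow> 'v word \<Rightarrow> int \<Rightarrow> int \<Rightarrow> int" where
  "weight \<eta> \<epsilon> d [] j x = 0"
| "weight \<eta> \<epsilon> d (a # w) j x = letter_weight \<eta> \<epsilon> d a j x
    + weight \<eta> \<epsilon> d w (j + letter_height \<eta> a) (x + letter_shift \<eta> \<epsilon> a j)"

lemma height_append [simp]: "height \<eta> (v @ w) = height \<eta> v + height \<eta> w"
  by (induction v) auto

lemma shift_append [simp]: "shift \<eta> \<epsilon> (v @ w) j = shift \<eta> \<epsilon> v j + shift \<eta> \<epsilon> w (j + height \<eta> v)"
  by (induction v arbitrary: j) (auto simp: add.assoc)

lemma weight_append [simp]:
  "weight \<eta> \<epsilon> d (v @ w) j x
    = weight \<eta> \<epsilon> d v j x + weight \<eta> \<epsilon> d w (j + height \<eta> v) (x + shift \<eta> \<epsilon> v j)"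
  by (induction v arbitrary: j x) (auto simp: add.assoc)

lemma weight_diff:
  "weight \<eta> \<epsilon> (\<lambda>s j x. d s j x - d' s j x) w j x = weight \<eta> \<epsilon> d w j x - weight \<eta> \<epsilon> d' w j x"
  by (induction w arbitrary: j x) (auto simp: letter_weight_def)

lemma weight_periodic:
  assumes "\<And>s j x y. [x = y] (mod Q) \<Longrightarrow> d s j x = d s j y" "[x = y] (mod Q)"
  shows "weight \<eta> \<epsilon> d w j x = weight \<eta> \<epsilon> d w j y"
  using assms(2)
proof (induction w arbitrary: j x y)
  case (Cons a w)
  have "letter_weight \<eta> \<epsilon> d a j x = letter_weight \<eta> \<epsilon> d a j y"
    unfolding letter_weight_def
    using assms(1)[OF Cons.prems] assms(1)[OF cong_diff[OF Cons.prems cong_refl]] by simp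
  moreover have "weight \<eta> \<epsilon> d w (j + letter_height \<eta> a) (x + letter_shift \<eta> \<epsilon> a j)
      = weight \<eta> \<epsilon> d w (j + letter_height \<eta> a) (y + letter_shift \<eta> \<epsilon> a j)"
    by (rule Cons.IH[OF cong_add[OF Cons.prems cong_refl]])
  ultimately show ?case by simp
qed simp

lemma weight_vanishes_high:
  assumes d: "\<And>s j x. j \<ge> L \<Longrightarrow> d s j x = 0"
  shows "\<exists>b. \<forall>j>b. \<forall>x. weight \<eta> \<epsilon> d w j x = 0"
proof (induction w)
  case (Cons a w)
  then obtain b where b: "\<And>j x. j > b \<Longrightarrow> weight \<eta> \<epsilon> d w j x = 0" by blast
  let ?c = "\<bar>\<eta> (fst a)\<bar>"
  have "weight \<eta> \<epsilon> d (a # w) j x = 0" if "j > max b L + ?c" for j x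
  proof -
    have "j + letter_height \<eta> a > b" "j \<ge> L" "j - \<eta> (fst a) \<ge> L"
      using that by (auto simp: letter_height_def)
    then show ?thesis using b d by (auto simp: letter_weight_def)
  qed
  then show ?case by blast
qed simp

text \<open>
  The second coordinate matters only modulo \<open>Q\<close>, as the weights have period \<open>Q\<close>, and the
  weights only modulo \<open>p\<close>. With these identifications the walk descends to the presented group as
  soon as it respects the relators.
\<close>

lemma word_cong_walk:
  assumes rel: "\<And>a b j. (a, b) \<in> Rel \<Longrightarrow> height \<eta> a = height \<eta> b"
      "\<And>a b j. (a, b) \<in> Rel \<Longrightarrow> [shift \<eta> \<epsilon> a j = shift \<eta> \<epsilon> b j] (mod Q)"
      "\<And>a b j x. (a, b) \<in> Rel \<Longrightarrow> [weight \<eta> \<epsilon> d a j x = weight \<eta> \<epsilon> d b j x] (mod p)"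
    and per: "\<And>s j x y. [x = y] (mod Q) \<Longrightarrow> d s j x = d s j y"
    and "(v, w) \<in> word_cong S Rel"
  shows "height \<eta> v = height \<eta> w \<and> (\<forall>j. [shift \<eta> \<epsilon> v j = shift \<eta> \<epsilon> w j] (mod Q))
    \<and> (\<forall>j x. [weight \<eta> \<epsilon> d v j x = weight \<eta> \<epsilon> d w j x] (mod p))"
  using assms(5)
proof (induction rule: word_cong.induct)
  case (sym v w)
  then show ?case by (auto intro: cong_sym)
next
  case (trans v w x)
  then show ?case by (metis cong_trans)
next
  case (cancel v w s e)
  have "height \<eta> [(s, e), (s, \<not> e)] = 0" "shift \<eta> \<epsilon> [(s, e), (s, \<not> e)] j = 0"
    "weight \<eta> \<epsilon> d [(s, e), (s, \<not> e)] j x = 0" for j x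
    by (cases e; simp add: letter_height_def letter_shift_def letter_weight_def)+
  then show ?case by (simp only: height_append shift_append weight_append) simp
next
  case (rel a b v w)
  note r = assms(1-3)[OF rel(1)]
  have "weight \<eta> \<epsilon> d w (j + height \<eta> v + height \<eta> a) (x + shift \<eta> \<epsilon> v j + shift \<eta> \<epsilon> a (j + height \<eta> v))
    = weight \<eta> \<epsilon> d w (j + height \<eta> v + height \<eta> b) (x + shift \<eta> \<epsilon> v j + shift \<eta> \<epsilon> b (j + height \<eta> v))" for j x
    unfolding r(1) by (rule weight_periodic[OF per cong_add[OF cong_refl r(2)]])
  then show ?case by (auto simp: r(1) intro!: cong_add r)
qed simp

lemma alternating_height: "\<eta> s = c \<Longrightarrow> \<eta> t = c \<Longrightarrow> height \<eta> (alternating m s t) = int m * c"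
  by (induction m arbitrary: s t) (auto simp: letter_height_def algebra_simps)

lemma alternating_shift_descending:
  "\<eta> s = -1 \<Longrightarrow> \<eta> t = -1 \<Longrightarrow>
    shift \<eta> \<epsilon> (alternating m s t) j = (\<Sum>r<m. \<epsilon> (if even r then s else t) (j - int r))"
proof (induction m arbitrary: s t j)
  case (Suc m)
  show ?case
    unfolding sum.lessThan_Suc_shift
    by (simp add: Suc letter_shift_def letter_height_def) (auto intro!: sum.cong simp: algebra_simps)
qed simp

lemma alternating_weight_support:
  assumes "\<eta> s = -1" "\<eta> t = -1" and d: "\<And>s j x. j < 0 \<or> j \<ge> L \<Longrightarrow> d s j x = 0"
    and "j < 0 \<or> j \<ge> L + int m"
  shows "weight \<eta> \<epsilon> d (alternating m s t) j x = 0"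
  using assms(1,2,4)
proof (induction m arbitrary: s t j x)
  case (Suc m)
  then have "letter_weight \<eta> \<epsilon> d (s, True) j x = 0" using d[of j] by (auto simp: letter_weight_def)
  moreover have "weight \<eta> \<epsilon> d (alternating m t s) (j - 1) y = 0" for y
    using Suc.prems by (intro Suc.IH) auto
  ultimately show ?case using Suc.prems by (simp add: letter_height_def)
qed simp

text \<open>
  Both sides of an even braid relation go \<open>k\<close> times round a loop of height zero, so each side meets
  the edges of \<open>t\<close> at one height only. The starting letter decides whether this is \<open>j + 1\<close> or \<open>j\<close>.
\<close>

lemma alternating_even_walk:
  assumes s: "\<eta> s = 1" "\<And>j. \<epsilon> s j = 0" "\<And>j x. d s j x = 0" and t: "\<eta> t = -1"
  shows "height \<eta> (alternating (2 * k) s t) = 0" "height \<eta> (alternating (2 * k) t s) = 0"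
    "shift \<eta> \<epsilon> (alternating (2 * k) s t) j = int k * \<epsilon> t (j + 1)"
    "shift \<eta> \<epsilon> (alternating (2 * k) t s) j = int k * \<epsilon> t j"
    "weight \<eta> \<epsilon> d (alternating (2 * k) s t) j x = (\<Sum>r<k. d t (j + 1) (x + int r * \<epsilon> t (j + 1)))"
    "weight \<eta> \<epsilon> d (alternating (2 * k) t s) j x = (\<Sum>r<k. d t j (x + int r * \<epsilon> t j))"
proof -
  note defs = letter_height_def letter_shift_def letter_weight_def
  show "height \<eta> (alternating (2 * k) s t) = 0" "height \<eta> (alternating (2 * k) t s) = 0"
    by (induction k) (simp_all add: s t defs)
  show "shift \<eta> \<epsilon> (alternating (2 * k) s t) j = int k * \<epsilon> t (j + 1)"
    "shift \<eta> \<epsilon> (alternating (2 * k) t s) j = int k * \<epsilon> t j"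
    by (induction k) (simp_all add: s t defs algebra_simps)
  show "weight \<eta> \<epsilon> d (alternating (2 * k) s t) j x = (\<Sum>r<k. d t (j + 1) (x + int r * \<epsilon> t (j + 1)))"
  proof (induction k arbitrary: x)
    case (Suc k)
    show ?case unfolding sum.lessThan_Suc_shift by (simp add: Suc s t defs add_ac distrib_right)
  qed simp
  show "weight \<eta> \<epsilon> d (alternating (2 * k) t s) j x = (\<Sum>r<k. d t j (x + int r * \<epsilon> t j))"
  proof (induction k arbitrary: x)
    case (Suc k)
    show ?case unfolding sum.lessThan_Suc_shift by (simp add: Suc s t defs add_ac distrib_right)
  qed simp
qed

section \<open>Zero-sum functions on the integers\<close>

lemma sum_residues:
  fixes q :: nat and b x :: int and g :: "int \<Rightarrow> int"
  assumes q: "q > 0" and b: "coprime b (int q)" and g: "\<And>x y. [x = y] (mod int q) \<Longrightarrow> g x = g y"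
  shows "(\<Sum>r<q. g (x + int r * b)) = (\<Sum>r<q. g (int r))"
proof -
  let ?f = "\<lambda>r. nat ((x + int r * b) mod int q)"
  have "inj_on ?f {..<q}"
  proof (rule inj_onI)
    fix r r' assume r: "r \<in> {..<q}" "r' \<in> {..<q}" and "?f r = ?f r'"
    then have "[x + int r * b = x + int r' * b] (mod int q)"
      using q by (simp add: cong_def eq_nat_nat_iff)
    then have "[int r * b = int r' * b] (mod int q)" by (simp add: cong_add_lcancel)
    then have "[int r = int r'] (mod int q)" using b by (simp add: cong_mult_rcancel)
    then show "r = r'" using r by (simp add: cong_def)
  qed
  moreover have "?f ` {..<q} \<subseteq> {..<q}" using q by (auto simp: nat_less_iff)
  ultimately have "bij_betw ?f {..<q} {..<q}"
    by (simp add: bij_betw_def endo_inj_surj)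
  then have "(\<Sum>r<q. g (int r)) = (\<Sum>r<q. g (int (?f r)))"
    by (rule sum.reindex_bij_betw[symmetric])
  also have "\<dots> = (\<Sum>r<q. g (x + int r * b))"
    using q by (intro sum.cong HOL.refl g) simp
  finally show ?thesis by simp
qed

text \<open>
  For a set \<open>S\<close> of primes, functions on \<open>\<int> / \<Prod>S\<close> whose sum over each coset of each subgroup of
  prime order \<open>q\<close> vanishes modulo \<open>p\<close>. A shift \<open>b\<close> divisible by the other primes of \<open>S\<close> and prime to \<open>q\<close>
  generates that subgroup, so on these functions it satisfies the equation
  \<open>1 + b + \<dots> + b\<^bsup>q-1\<^esup> = 0\<close> of a nontrivial \<open>q\<close>-th root of unity.
\<close>

definition zero_sum_functions :: "nat set \<Rightarrow> int \<Rightarrow> (int \<Rightarrow> int) set" where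
  "zero_sum_functions S p = {f. (\<forall>x y. [x = y] (mod int (\<Prod>S)) \<longrightarrow> f x = f y) \<and>
    (\<forall>q\<in>S. \<forall>b. (\<forall>q'\<in>S - {q}. int q' dvd b) \<longrightarrow> coprime b (int q)
      \<longrightarrow> (\<forall>x. p dvd (\<Sum>r<q. f (x + int r * b))))}"

lemma zero_sum_functionsI:
  assumes "\<And>x y. [x = y] (mod int (\<Prod>S)) \<Longrightarrow> f x = f y"
    and "\<And>q b x. q \<in> S \<Longrightarrow> (\<And>q'. q' \<in> S \<Longrightarrow> q' \<noteq> q \<Longrightarrow> int q' dvd b) \<Longrightarrow> coprime b (int q)
      \<Longrightarrow> p dvd (\<Sum>r<q. f (x + int r * b))"
  shows "f \<in> zero_sum_functions S p"
  using assms unfolding zero_sum_functions_def by blast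

lemma zero_sum_functionsD:
  assumes "f \<in> zero_sum_functions S p"
  shows "[x = y] (mod int (\<Prod>S)) \<Longrightarrow> f x = f y"
    and "q \<in> S \<Longrightarrow> (\<And>q'. q' \<in> S \<Longrightarrow> q' \<noteq> q \<Longrightarrow> int q' dvd b) \<Longrightarrow> coprime b (int q)
      \<Longrightarrow> p dvd (\<Sum>r<q. f (x + int r * b))"
  using assms unfolding zero_sum_functions_def by blast+

lemma zero_sum_zero: "(\<lambda>x. 0) \<in> zero_sum_functions S p"
  by (rule zero_sum_functionsI) auto

lemma zero_sum_add:
  assumes f: "f \<in> zero_sum_functions S p" and g: "g \<in> zero_sum_functions S p"
  shows "(\<lambda>x. f x + g x) \<in> zero_sum_functions S p"
proof (rule zero_sum_functionsI)
  show "f x + g x = f y + g y" if "[x = y] (mod int (\<Prod>S))" for x y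
    using zero_sum_functionsD(1)[OF f that] zero_sum_functionsD(1)[OF g that] by simp
  show "p dvd (\<Sum>r<q. f (x + int r * b) + g (x + int r * b))"
    if "q \<in> S" "\<And>q'. q' \<in> S \<Longrightarrow> q' \<noteq> q \<Longrightarrow> int q' dvd b" "coprime b (int q)" for q b x
    unfolding sum.distrib
    by (rule dvd_add[OF zero_sum_functionsD(2)[OF f] zero_sum_functionsD(2)[OF g]]) (use that in auto)
qed

lemma zero_sum_uminus:
  assumes f: "f \<in> zero_sum_functions S p"
  shows "(\<lambda>x. - f x) \<in> zero_sum_functions S p"
proof (rule zero_sum_functionsI)
  show "- f x = - f y" if "[x = y] (mod int (\<Prod>S))" for x y
    using zero_sum_functionsD(1)[OF f that] by simp
  show "p dvd (\<Sum>r<q. - f (x + int r * b))"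
    if "q \<in> S" "\<And>q'. q' \<in> S \<Longrightarrow> q' \<noteq> q \<Longrightarrow> int q' dvd b" "coprime b (int q)" for q b x
    unfolding sum_negf dvd_minus_iff by (rule zero_sum_functionsD(2)[OF f]) (use that in auto)
qed

lemma zero_sum_translate:
  assumes f: "f \<in> zero_sum_functions S p"
  shows "(\<lambda>x. f (x + c)) \<in> zero_sum_functions S p"
proof (rule zero_sum_functionsI)
  show "f (x + c) = f (y + c)" if "[x = y] (mod int (\<Prod>S))" for x y
    using zero_sum_functionsD(1)[OF f cong_add[OF that cong_refl]] .
  show "p dvd (\<Sum>r<q. f (x + int r * b + c))"
    if "q \<in> S" "\<And>q'. q' \<in> S \<Longrightarrow> q' \<noteq> q \<Longrightarrow> int q' dvd b" "coprime b (int q)" for q b x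
    using zero_sum_functionsD(2)[OF f that, of "x + c"] by (simp add: algebra_simps)
qed

lemma zero_sum_mod:
  assumes f: "f \<in> zero_sum_functions S p"
  shows "(\<lambda>x. f x mod p) \<in> zero_sum_functions S p"
proof (rule zero_sum_functionsI)
  show "f x mod p = f y mod p" if "[x = y] (mod int (\<Prod>S))" for x y
    using zero_sum_functionsD(1)[OF f that] by simp
  show "p dvd (\<Sum>r<q. f (x + int r * b) mod p)"
    if "q \<in> S" "\<And>q'. q' \<in> S \<Longrightarrow> q' \<noteq> q \<Longrightarrow> int q' dvd b" "coprime b (int q)" for q b x
    using zero_sum_functionsD(2)[OF f that, of x] by (simp add: dvd_eq_mod_eq_0 mod_sum_eq)
qed

lemma weight_zero_sum:
  assumes "\<And>s j. d s j \<in> zero_sum_functions S p"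
  shows "weight \<eta> \<epsilon> d w j \<in> zero_sum_functions S p"
proof (induction w arbitrary: j)
  case Nil
  then show ?case using zero_sum_zero by (simp add: fun_eq_iff[symmetric] cong: if_cong)
next
  case (Cons a w)
  have "letter_weight \<eta> \<epsilon> d a j \<in> zero_sum_functions S p"
  proof (cases "snd a")
    case True
    then have "letter_weight \<eta> \<epsilon> d a j = d (fst a) j" by (simp add: letter_weight_def fun_eq_iff)
    then show ?thesis using assms by simp
  next
    case False
    let ?j = "j - \<eta> (fst a)"
    have "letter_weight \<eta> \<epsilon> d a j = (\<lambda>x. - d (fst a) ?j (x + - \<epsilon> (fst a) ?j))"
      using False by (simp add: letter_weight_def fun_eq_iff)
    then show ?thesis using zero_sum_uminus[OF zero_sum_translate[OF assms, of _ _ "- \<epsilon> (fst a) ?j"]] by simp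
  qed
  from zero_sum_add[OF this zero_sum_translate[OF Cons]] show ?case
    by (simp add: fun_eq_iff[symmetric] cong: if_cong)
qed

lemma sum_over_multiple:
  assumes f: "f \<in> zero_sum_functions S p" and q: "q \<in> S"
    and b: "\<And>q'. q' \<in> S \<Longrightarrow> q' \<noteq> q \<Longrightarrow> int q' dvd b" "coprime b (int q)" and "q dvd k"
  shows "p dvd (\<Sum>r<k. f (x + int r * b))"
proof -
  obtain n where "k = n * q" using \<open>q dvd k\<close> by (metis dvd_def mult.commute)
  moreover have "p dvd (\<Sum>r<n * q. f (x + int r * b))"
    unfolding sum.nat_group[symmetric]
  proof (rule dvd_sum)
    fix m
    have "(\<Sum>r\<in>{m * q..<m * q + q}. f (x + int r * b)) = (\<Sum>r<q. f ((x + int (m * q) * b) + int r * b))"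
      using sum.shift_bounds_nat_ivl[of "\<lambda>r. f (x + int r * b)" 0 "m * q" q]
      by (simp add: algebra_simps lessThan_atLeast0)
    then show "p dvd (\<Sum>r\<in>{m * q..<m * q + q}. f (x + int r * b))"
      using zero_sum_functionsD(2)[OF f q b] by simp
  qed
  ultimately show ?thesis by simp
qed

text \<open>
  The function \<open>1, -1, 0, \<dots>, 0\<close> on the residues modulo \<open>q\<close>. A shift that generates the subgroup of
  order \<open>q\<close> changes only the residue modulo \<open>q\<close>, so the product of these functions over the primes
  is a zero-sum function, and it is nonzero modulo every \<open>p > 1\<close>.
\<close>

definition residue_bump :: "nat \<Rightarrow> int \<Rightarrow> int" where
  "residue_bump q x = (if [x = 0] (mod int q) then 1 else if [x = 1] (mod int q) then -1 else 0)"

lemma zero_sum_function_nontrivial: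
  assumes S: "finite S" "\<And>q. q \<in> S \<Longrightarrow> q \<ge> 2"
  shows "(\<lambda>x. \<Prod>q\<in>S. residue_bump q x) \<in> zero_sum_functions S p" "(\<Prod>q\<in>S. residue_bump q 0) = 1"
proof -
  have per: "residue_bump q x = residue_bump q y" if "[x = y] (mod int q)" for q x y
    using that by (simp add: residue_bump_def cong_def)
  have sum0: "(\<Sum>r<q. residue_bump q (int r)) = 0" if "q \<ge> 2" for q
  proof -
    have "(\<Sum>r<q. residue_bump q (int r)) = (\<Sum>r<q. (if r = 0 then 1 else 0) + (if r = 1 then -1 else 0))"
      using that by (intro sum.cong HOL.refl) (auto simp: residue_bump_def cong_def)
    then show ?thesis using that by (simp add: sum.distrib)
  qed
  show "(\<Prod>q\<in>S. residue_bump q 0) = 1" by (simp add: residue_bump_def)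
  show "(\<lambda>x. \<Prod>q\<in>S. residue_bump q x) \<in> zero_sum_functions S p"
  proof (rule zero_sum_functionsI)
    fix x y assume "[x = y] (mod int (\<Prod>S))"
    then have "[x = y] (mod int q)" if "q \<in> S" for q
      using cong_dvd_modulus dvd_prodI[OF S(1) that, of "\<lambda>q. q"] by (metis int_dvd_int_iff)
    then show "(\<Prod>q\<in>S. residue_bump q x) = (\<Prod>q\<in>S. residue_bump q y)"
      by (intro prod.cong HOL.refl per)
  next
    fix q b x assume q: "q \<in> S" and b: "\<And>q'. q' \<in> S \<Longrightarrow> q' \<noteq> q \<Longrightarrow> int q' dvd b" "coprime b (int q)"
    have "(\<Prod>q'\<in>S. residue_bump q' (x + int r * b))
      = residue_bump q (x + int r * b) * (\<Prod>q'\<in>S - {q}. residue_bump q' x)" for r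
    proof -
      have "(\<Prod>q'\<in>S - {q}. residue_bump q' (x + int r * b)) = (\<Prod>q'\<in>S - {q}. residue_bump q' x)"
        using b(1) by (intro prod.cong HOL.refl per) (auto simp: cong_iff_dvd_diff)
      then show ?thesis using prod.remove[OF S(1) q] by metis
    qed
    then have "(\<Sum>r<q. \<Prod>q'\<in>S. residue_bump q' (x + int r * b)) =
      (\<Sum>r<q. residue_bump q (x + int r * b)) * (\<Prod>q'\<in>S - {q}. residue_bump q' x)"
      by (simp add: sum_distrib_right)
    also have "(\<Sum>r<q. residue_bump q (x + int r * b)) = 0"
      using sum_residues[OF _ b(2), of "residue_bump q"] per sum0 S(2)[OF q] by simp
    finally show "p dvd (\<Sum>r<q. \<Prod>q'\<in>S. residue_bump q' (x + int r * b))" by simp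
  qed
qed

text \<open>Representatives modulo \<open>p\<close>; the pigeonhole principle needs a finite set of values.\<close>

definition reduced_zero_sum :: "nat set \<Rightarrow> int \<Rightarrow> (int \<Rightarrow> int) set" where
  "reduced_zero_sum S p = {f \<in> zero_sum_functions S p. range f \<subseteq> {0..<p}}"

lemma finite_reduced_zero_sum:
  assumes "\<Prod>S > 0"
  shows "finite (reduced_zero_sum S p)"
proof -
  define Q where "Q = int (\<Prod>S)"
  have Q: "Q > 0" unfolding Q_def using assms by (simp only: of_nat_0_less_iff)
  have "f = (\<lambda>x. restrict f {0..<Q} (x mod Q))" if "f \<in> reduced_zero_sum S p" for f
  proof
    fix x
    have "f x = f (x mod Q)"
      using that zero_sum_functionsD(1)[of f S p x "x mod Q"] by (simp add: reduced_zero_sum_def cong_def Q_def)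
    then show "f x = restrict f {0..<Q} (x mod Q)" using Q by simp
  qed
  moreover have "restrict f {0..<Q} \<in> {0..<Q} \<rightarrow>\<^sub>E {0..<p}" if "f \<in> reduced_zero_sum S p" for f
    using that by (auto simp: reduced_zero_sum_def)
  ultimately have "reduced_zero_sum S p \<subseteq> (\<lambda>g x. g (x mod Q)) ` ({0..<Q} \<rightarrow>\<^sub>E {0..<p})"
    by blast
  then show ?thesis by (rule finite_subset) (intro finite_imageI finite_PiE; simp)
qed

lemma card_reduced_zero_sum:
  assumes S: "finite S" "\<And>q. q \<in> S \<Longrightarrow> q \<ge> 2" and p: "p > 1"
  shows "card (reduced_zero_sum S p) \<ge> 2"
proof -
  let ?h = "\<lambda>x. (\<Prod>q\<in>S. residue_bump q x) mod p"
  have "?h \<in> reduced_zero_sum S p" "(\<lambda>x. 0) \<in> reduced_zero_sum S p"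
    using zero_sum_mod[OF zero_sum_function_nontrivial(1)[OF S]] zero_sum_zero p
    by (auto simp: reduced_zero_sum_def)
  moreover have "?h 0 = 1" using zero_sum_function_nontrivial(2)[OF S] p by simp
  then have "?h \<noteq> (\<lambda>x. 0)" by (metis zero_neq_one)
  moreover have "\<Prod>S > 0" using S by (intro prod_pos) fastforce
  ultimately show ?thesis
    using card_mono[OF finite_reduced_zero_sum, of S "{?h, \<lambda>x. 0}" p] by simp
qed

section \<open>Exponents with vanishing alternating sums\<close>

definition window_sign :: "int \<Rightarrow> int" where
  "window_sign j = (if even j then 1 else -1)"

text \<open>
  Up to the sign \<open>(-1)\<^sup>j\<close>, the sequence of period \<open>m\<close> that starts with \<open>1, -2, 1, -1, 1, \<dots>, -1, 1\<close>. The
  sum over a period is zero for odd \<open>m\<close>. All entries are prime to every odd prime, and for the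
  prime \<open>2\<close> exactly one entry per period fails to be so, which is the least possible.
\<close>

definition window_shift :: "nat \<Rightarrow> int \<Rightarrow> int" where
  "window_shift m j = window_sign j * (if j mod int m = 1 then -2 else window_sign (j mod int m))"

lemma window_shift_sum:
  assumes "odd m" "m > 1"
  shows "(\<Sum>r<m. (-1) ^ r * window_shift m (j - int r)) = 0"
proof -
  let ?b = "\<lambda>j. if j mod int m = 1 then -2 else window_sign (j mod int m)"
  have "(-1) ^ r * window_sign (j - int r) = window_sign j" for r
    by (auto simp: window_sign_def)
  then have "(\<Sum>r<m. (-1) ^ r * window_shift m (j - int r)) = window_sign j * (\<Sum>r<m. ?b (j - int r))"
    unfolding window_shift_def sum_distrib_left mult.assoc[symmetric] by simp
  also have "(\<Sum>r<m. ?b (j - int r)) = (\<Sum>r<m. ?b (int r))"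
  proof -
    have "(\<Sum>r<m. ?b (j + int r * (- 1))) = (\<Sum>r<m. ?b (int r))"
    proof (rule sum_residues)
      show "?b x = ?b y" if "[x = y] (mod int m)" for x y using that unfolding cong_def by (simp only:)
    qed (use assms in simp_all)
    then show ?thesis by (simp only: mult_minus1_right add_uminus_conv_diff)
  qed
  also have "\<dots> = (\<Sum>r<m. (-1) ^ r + (if r = 1 then -1 else 0))"
    using assms by (intro sum.cong HOL.refl) (auto simp: window_sign_def)
  also have "\<dots> = 0"
  proof -
    have "(\<Sum>r<2 * l + 1. (-1) ^ r) = (1::int)" for l by (induction l) auto
    moreover obtain l where "m = 2 * l + 1" using assms(1) by (rule oddE)
    ultimately have "(\<Sum>r<m. (-1) ^ r) = (1::int)" by (simp only:)
    then show ?thesis using assms by (simp add: sum.distrib)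
  qed
  finally show ?thesis by simp
qed

section \<open>From weighted walks to the Sigma invariant\<close>

lemma presented_group_class:
  assumes "g \<in> carrier (presented_group S Rel)"
  obtains w where "w \<in> words S" "g = word_cong S Rel `` {w}"
  using assms by (auto simp: presented_group_def quotient_def)

lemma presented_group_class_closed:
  "w \<in> words S \<Longrightarrow> word_cong S Rel `` {w} \<in> carrier (presented_group S Rel)"
  by (auto simp: presented_group_def intro: quotientI)

lemma presented_group_char_append:
  assumes "\<chi> \<in> hom (presented_group S Rel) real_group" "v \<in> words S" "w \<in> words S"
  shows "\<chi> (word_cong S Rel `` {v @ w}) = \<chi> (word_cong S Rel `` {v}) + \<chi> (word_cong S Rel `` {w})"
  using hom_mult[OF assms(1) presented_group_class_closed[OF assms(2)] presented_group_class_closed[OF assms(3)]]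
  by (simp add: presented_group_mult[OF assms(2,3)] real_group_def)

lemma presented_group_char_height:
  assumes \<chi>: "\<chi> \<in> hom (presented_group S Rel) real_group"
    and gens: "\<And>s. s \<in> S \<Longrightarrow> \<chi> (presented_gen S Rel s) = real_of_int (\<eta> s)"
    and "w \<in> words S"
  shows "\<chi> (word_cong S Rel `` {w}) = real_of_int (height \<eta> w)"
  using assms(3)
proof (induction w)
  case Nil
  then show ?case using presented_group_char_append[OF \<chi> Nil Nil] by simp
next
  case (Cons a w)
  obtain s e where a: "a = (s, e)" by force
  have s: "s \<in> S" "w \<in> words S" "[] \<in> words S" "[(s, b)] \<in> words S" for b
    using Cons.prems by (auto simp: words_def a)
  have nil: "\<chi> (word_cong S Rel `` {[]}) = 0"
    using presented_group_char_append[OF \<chi> s(3) s(3)] by simp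
  have "([(s, True), (s, False)], []) \<in> word_cong S Rel"
    using word_cong.cancel[OF s(3) s(3) s(1), of True] by simp
  then have "word_cong S Rel `` {[(s, True), (s, False)]} = word_cong S Rel `` {[]}"
    by (rule equiv_class_eq[OF equiv_word_cong])
  then have "\<chi> (word_cong S Rel `` {[(s, False)]}) = - real_of_int (\<eta> s)"
    using presented_group_char_append[OF \<chi> s(4)[of True] s(4)[of False]] nil gens[OF s(1)]
    by (simp add: presented_gen_def)
  then have "\<chi> (word_cong S Rel `` {[a]}) = letter_height \<eta> a"
    using gens[OF s(1)] by (cases e) (simp_all add: a letter_height_def presented_gen_def)
  then show ?case
    using presented_group_char_append[OF \<chi> s(4)[of e] s(2)] Cons.IH[OF s(2)] by (simp add: a)
qed

text \<open>
  The letter \<open>u\<close> moves straight up at no cost, so the word \<open>u\<^bsup>-r\<^esup> t u\<^bsup>r+1\<^esup>\<close>, which has height zero,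
  carries the nonzero weight of the edge \<open>t\<close> at \<open>(j0, x0)\<close> to the point \<open>(j0 + r, x0)\<close>. Hence the
  derivation given by the weights reaches arbitrarily high.
\<close>

theorem Sigma1_complement_of_weighted_walk:
  assumes rel: "\<And>a b j. (a, b) \<in> Rel \<Longrightarrow> height \<eta> a = height \<eta> b"
      "\<And>a b j. (a, b) \<in> Rel \<Longrightarrow> [shift \<eta> \<epsilon> a j = shift \<eta> \<epsilon> b j] (mod Q)"
      "\<And>a b j x. (a, b) \<in> Rel \<Longrightarrow> [weight \<eta> \<epsilon> d a j x = weight \<eta> \<epsilon> d b j x] (mod p)"
    and per: "\<And>s j x y. [x = y] (mod Q) \<Longrightarrow> d s j x = d s j y"
    and bdd: "\<And>s j x. j \<ge> L \<Longrightarrow> d s j x = 0"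
    and \<chi>: "\<chi> \<in> hom (presented_group S Rel) real_group"
    and gens: "\<And>s. s \<in> S \<Longrightarrow> \<chi> (presented_gen S Rel s) = real_of_int (\<eta> s)"
    and u: "u \<in> S" "\<eta> u = 1" "\<And>j. \<epsilon> u j = 0" "\<And>j x. d u j x = 0"
    and t: "t \<in> S" "\<eta> t = -1" "\<not> p dvd d t j0 x0"
  shows "char_class (presented_group S Rel) \<chi>
    \<in> char_sphere (presented_group S Rel) - Sigma1 TYPE('m) (presented_group S Rel)"
proof -
  let ?G = "presented_group S Rel"
  let ?C = "\<lambda>w. word_cong S Rel `` {w}"
  define rep where "rep g = (SOME w. w \<in> words S \<and> g = ?C w)" for g
  have rep: "rep g \<in> words S" "g = ?C (rep g)" if "g \<in> carrier ?G" for g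
  proof -
    have "\<exists>w. w \<in> words S \<and> g = ?C w" using presented_group_class[OF that] by metis
    from someI_ex[OF this] show "rep g \<in> words S" "g = ?C (rep g)" unfolding rep_def by auto
  qed
  have walk: "height \<eta> (rep (?C w)) = height \<eta> w"
    "[weight \<eta> \<epsilon> d (rep (?C w)) j x = weight \<eta> \<epsilon> d w j x] (mod p)" if w: "w \<in> words S" for w j x
  proof -
    have "(rep (?C w), w) \<in> word_cong S Rel"
      using rep[OF presented_group_class_closed[OF w]] w
      by (simp add: eq_equiv_class_iff[OF equiv_word_cong] word_cong.sym)
    from word_cong_walk[OF rel per this]
    show "height \<eta> (rep (?C w)) = height \<eta> w"
      "[weight \<eta> \<epsilon> d (rep (?C w)) j x = weight \<eta> \<epsilon> d w j x] (mod p)" by blast+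
  qed
  have \<chi>_height: "\<chi> (?C w) = real_of_int (height \<eta> w)" if "w \<in> words S" for w
    using presented_group_char_height[OF \<chi> gens that] .
  show ?thesis
  proof (rule Sigma1_complement_criterion[where p = p and ht = "\<lambda>(j, x). real_of_int j"
        and act = "\<lambda>g (j, x). (j + height \<eta> (rep g), x + shift \<eta> \<epsilon> (rep g) j)"
        and D = "\<lambda>g (j, x). weight \<eta> \<epsilon> d (rep g) j x"])
    show "group ?G" by (rule group_presented_group)
    have uw: "[(u, True)] \<in> words S" using u by (simp add: words_def)
    have "\<chi> (?C [(u, True)]) = 1" using \<chi>_height[OF uw] u by (simp add: letter_height_def)
    then show "\<chi> \<in> nonzero_chars ?G"
      using \<chi> presented_group_class_closed[OF uw] unfolding nonzero_chars_def by force
  next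
    fix g h and y :: "int \<times> int" assume gh: "g \<in> carrier ?G" "h \<in> carrier ?G"
    obtain j x where y: "y = (j, x)" by force
    have app: "rep g @ rep h \<in> words S" using rep[OF gh(1)] rep[OF gh(2)] by (simp add: words_def)
    have "g \<otimes>\<^bsub>?G\<^esub> h = ?C (rep g @ rep h)"
      using presented_group_mult[OF rep(1)[OF gh(1)] rep(1)[OF gh(2)], of Rel]
        rep(2)[OF gh(1)] rep(2)[OF gh(2)] by simp
    then show "[(case y of (j, x) \<Rightarrow> weight \<eta> \<epsilon> d (rep (g \<otimes>\<^bsub>?G\<^esub> h)) j x) =
        (case y of (j, x) \<Rightarrow> weight \<eta> \<epsilon> d (rep g) j x) +
        (case case y of (j, x) \<Rightarrow> (j + height \<eta> (rep g), x + shift \<eta> \<epsilon> (rep g) j) of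
          (j, x) \<Rightarrow> weight \<eta> \<epsilon> d (rep h) j x)] (mod p)"
      using walk(2)[OF app, of j x] by (simp add: y)
  next
    fix g and y :: "int \<times> int" assume g: "g \<in> carrier ?G"
    have "\<chi> g = real_of_int (height \<eta> (rep g))" using \<chi>_height[OF rep(1)[OF g]] rep(2)[OF g] by simp
    then show "(case case y of (j, x) \<Rightarrow> (j + height \<eta> (rep g), x + shift \<eta> \<epsilon> (rep g) j) of
        (j, x) \<Rightarrow> real_of_int j) = (case y of (j, x) \<Rightarrow> real_of_int j) + \<chi> g"
      by (simp split: prod.split)
  next
    fix g assume "g \<in> carrier ?G"
    obtain b where "\<forall>j>b. \<forall>x. weight \<eta> \<epsilon> d (rep g) j x = 0"
      using weight_vanishes_high[of L d \<eta> \<epsilon> "rep g"] bdd by blast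
    then show "\<exists>b. \<forall>y. (case y of (j, x) \<Rightarrow> real_of_int j) > b
        \<longrightarrow> p dvd (case y of (j, x) \<Rightarrow> weight \<eta> \<epsilon> d (rep g) j x)"
      by (intro exI[of _ "real_of_int b"]) (auto split: prod.split)
  next
    fix b :: real
    obtain r :: nat where r: "real r > b - j0" using reals_Archimedean2 by blast
    let ?w = "replicate r (u, False) @ [(t, True)] @ replicate (Suc r) (u, True)"
    have w: "?w \<in> words S" using u t by (auto simp: words_def)
    have z: "height \<eta> (replicate r (u, e)) = (if e then int r else - int r)"
      "shift \<eta> \<epsilon> (replicate r (u, e)) j = 0" "weight \<eta> \<epsilon> d (replicate r (u, e)) j x = 0" for r e j x
      by (induction r arbitrary: j; cases e; simp add: u letter_height_def letter_shift_def letter_weight_def)+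
    have "weight \<eta> \<epsilon> d ?w (j0 + int r) x0 = d t j0 x0" "height \<eta> ?w = 0"
      using z[of _ True] z[of _ False] u t
      by (simp_all add: letter_height_def letter_shift_def letter_weight_def del: replicate_Suc)
    then have "\<not> p dvd weight \<eta> \<epsilon> d (rep (?C ?w)) (j0 + int r) x0" "\<chi> (?C ?w) = 0"
      using walk(2)[OF w, of "j0 + int r" x0] t(3) \<chi>_height[OF w] by (auto simp: cong_dvd_iff)
    then show "\<exists>g\<in>carrier ?G. 0 \<le> \<chi> g \<and> (\<exists>y. b < (case y of (j, x) \<Rightarrow> real_of_int j)
        \<and> \<not> p dvd (case y of (j, x) \<Rightarrow> weight \<eta> \<epsilon> d (rep g) j x))"
      using presented_group_class_closed[OF w] r
      by (intro bexI[of _ "?C ?w"] conjI exI[of _ "(j0 + int r, x0)"]) auto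
  qed
qed

section \<open>The weights for the Artin group\<close>

text \<open>A prime divisor of \<open>k\<close>, odd whenever there is an odd one.\<close>

definition chosen_prime :: "nat \<Rightarrow> nat" where
  "chosen_prime k = (SOME q. prime q \<and> q dvd k \<and> (q = 2 \<longrightarrow> (\<exists>e. k = 2 ^ e)))"

lemma chosen_prime:
  assumes "k > 1"
  shows "prime (chosen_prime k)" "chosen_prime k dvd k" "chosen_prime k = 2 \<Longrightarrow> \<exists>e. k = 2 ^ e"
proof -
  have "\<exists>q. prime q \<and> q dvd k \<and> (q = 2 \<longrightarrow> (\<exists>e. k = 2 ^ e))"
  proof (cases "\<exists>e. k = 2 ^ e")
    case True
    then show ?thesis using assms prime_factor_nat[of k] by auto
  next
    case False
    obtain c where c: "k = 2 ^ multiplicity 2 k * c" "\<not> 2 dvd c"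
      using multiplicity_decompose'[of k 2] assms by (auto simp: mult.commute)
    then have "c \<noteq> 1" using False by (metis mult.right_neutral)
    then obtain q where "prime q" "q dvd c" using prime_factor_nat by blast
    moreover have "q \<noteq> 2" using \<open>q dvd c\<close> c(2) by auto
    moreover have "q dvd k" using \<open>q dvd c\<close> by (subst c(1)) (rule dvd_mult)
    ultimately show ?thesis by blast
  qed
  from someI_ex[OF this]
  show "prime (chosen_prime k)" "chosen_prime k dvd k" "chosen_prime k = 2 \<Longrightarrow> \<exists>e. k = 2 ^ e"
    unfolding chosen_prime_def by auto
qed

locale even_odd_star =
  fixes n :: nat and k l :: "nat \<Rightarrow> nat"
  assumes n: "n \<ge> 1" and k: "\<And>i. i \<in> {1..n} \<Longrightarrow> k i > 1" and l: "\<And>i. i \<in> {2..n} \<Longrightarrow> l i > 0"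
begin

text \<open>
  \<open>m i\<close> is the odd label between \<open>u\<^sub>1\<close> and \<open>u\<^sub>i\<close>, the shifts of \<open>u\<^sub>i\<close> act as roots of unity of order
  dividing \<open>q i\<close>, and \<open>p\<close> is the modulus for the weights. The modulus \<open>k 1\<close> makes
  the even relation between \<open>u\<close> and \<open>u\<^sub>1\<close> hold although \<open>u\<^sub>1\<close> does not shift.
\<close>

definition m :: "nat \<Rightarrow> nat" where "m i = 2 * l i + 1"
definition q :: "nat \<Rightarrow> nat" where "q i = chosen_prime (k i)"
definition Q :: "nat set" where "Q = q ` {2..n}"
definition p :: int where "p = int (k 1)"
definition two_powers :: "nat set" where "two_powers = {i \<in> {2..n}. \<exists>e. k i = 2 ^ e}"

primrec \<eta> :: "vertex \<Rightarrow> int" where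
  "\<eta> U = 1" | "\<eta> (Ui i) = -1"

primrec \<epsilon> :: "vertex \<Rightarrow> int \<Rightarrow> int" where
  "\<epsilon> U j = 0"
| "\<epsilon> (Ui i) j = (if i \<in> {2..n} then int (\<Prod>(Q - {q i})) * window_shift (m i) j else 0)"

primrec edge_weights :: "(nat \<Rightarrow> int \<Rightarrow> int \<Rightarrow> int) \<Rightarrow> vertex \<Rightarrow> int \<Rightarrow> int \<Rightarrow> int" where
  "edge_weights e U = (\<lambda>j x. 0)" | "edge_weights e (Ui i) = e i"

text \<open>The amount by which the odd braid relation between \<open>u\<^sub>1\<close> and \<open>u\<^sub>i\<close> fails for the weights.\<close>

definition odd_defect :: "(nat \<Rightarrow> int \<Rightarrow> int \<Rightarrow> int) \<Rightarrow> nat \<Rightarrow> int \<Rightarrow> int \<Rightarrow> int" where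
  "odd_defect e i j x = weight \<eta> \<epsilon> (edge_weights e) (alternating (m i) (Ui 1) (Ui i)) j x
    - weight \<eta> \<epsilon> (edge_weights e) (alternating (m i) (Ui i) (Ui 1)) j x"

text \<open>
  The conditions on single weights under which the even relations hold, with support in finitely
  many heights, so that only finitely many equations remain for the odd relations.
\<close>

definition admissible :: "int \<Rightarrow> (nat \<Rightarrow> int \<Rightarrow> int \<Rightarrow> int) \<Rightarrow> bool" where
  "admissible L e \<longleftrightarrow> (\<forall>i j. e i j \<in> zero_sum_functions Q p)
    \<and> (\<forall>i j. (j < 0 \<or> j \<ge> L) \<longrightarrow> e i j = (\<lambda>x. 0))
    \<and> (\<forall>i\<in>two_powers. \<forall>j. j mod int (m i) = 1 \<longrightarrow> e i j = (\<lambda>x. 0))"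

lemma Q_primes: "finite Q" "r \<in> Q \<Longrightarrow> prime r"
  using chosen_prime(1) k by (auto simp: Q_def q_def)

lemma q: "i \<in> {2..n} \<Longrightarrow> q i \<in> Q" "i \<in> {2..n} \<Longrightarrow> q i dvd k i"
  using chosen_prime(2) k by (auto simp: Q_def q_def)

lemma p: "p > 1" using k[of 1] n by (simp add: p_def)

lemma admissible_edge_weights:
  assumes "admissible L e"
  shows "edge_weights e s j \<in> zero_sum_functions Q p"
    "j < 0 \<or> j \<ge> L \<Longrightarrow> edge_weights e s j x = 0"
  using assms zero_sum_zero by (cases s; auto simp: admissible_def)+

text \<open>
  The even relations hold for all admissible weights: at \<open>u\<^sub>1\<close> by the choice of the modulus, and
  at the other \<open>u\<^sub>i\<close> because the shift generates the subgroup of order \<open>q i\<close>, except for \<open>q i = 2\<close> at the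
  entries \<open>-2\<close> of \<open>window_shift\<close>, where the weights are zero.
\<close>

lemma even_sum:
  assumes e: "admissible L e" and i: "i \<in> {1..n}"
  shows "p dvd (\<Sum>r<k i. e i j (x + int r * \<epsilon> (Ui i) j))"
proof (cases "i = 1")
  case True
  then show ?thesis by (simp add: p_def)
next
  case False
  then have i: "i \<in> {2..n}" using i by auto
  let ?c = "int (\<Prod>(Q - {q i}))"
  have qp: "prime (q i)" using Q_primes q i by blast
  show ?thesis
  proof (cases "i \<in> two_powers \<and> j mod int (m i) = 1")
    case True
    then show ?thesis using e by (simp add: admissible_def)
  next
    case False
    \<comment> \<open>The entries of \<open>window_shift\<close> are \<open>\<plusminus>1\<close> and \<open>\<plusminus>2\<close>; an entry \<open>\<plusminus>2\<close> is left only for odd \<open>q i\<close>.\<close>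
    have "coprime (window_shift (m i) j) (int (q i))"
    proof (cases "j mod int (m i) = 1")
      case True
      with False have "q i \<noteq> 2"
        using chosen_prime(3)[of "k i"] k[of i] i by (auto simp: two_powers_def q_def)
      then have "coprime (2::int) (int (q i))"
        using qp by (metis coprime_int_iff of_nat_numeral primes_coprime two_is_prime_nat)
      then show ?thesis using True by (simp add: window_shift_def window_sign_def)
    next
      case False
      then show ?thesis by (simp add: window_shift_def window_sign_def)
    qed
    moreover have "coprime ?c (int (q i))"
      unfolding coprime_int_iff
      by (rule prod_coprime_left) (use Q_primes qp primes_coprime in auto)
    ultimately have "coprime (?c * window_shift (m i) j) (int (q i))" by simp
    moreover have "int q' dvd ?c * window_shift (m i) j" if "q' \<in> Q" "q' \<noteq> q i" for q'
    proof -
      have "q' dvd \<Prod>(Q - {q i})" using dvd_prodI[of "Q - {q i}" q' "\<lambda>r. r"] Q_primes(1) that by simp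
      then show ?thesis by (intro dvd_mult2) (simp only: int_dvd_int_iff)
    qed
    ultimately show ?thesis
      using sum_over_multiple[of "e i j" Q p "q i" "?c * window_shift (m i) j" "k i" x] e q[OF i] i
      by (simp add: admissible_def)
  qed
qed

lemma even_shift:
  assumes "i \<in> {1..n}"
  shows "[int (k i) * \<epsilon> (Ui i) j = 0] (mod int (\<Prod>Q))"
proof (cases "i = 1")
  case False
  then have i: "i \<in> {2..n}" using assms by auto
  have "\<Prod>Q = q i * \<Prod>(Q - {q i})" using prod.remove[OF Q_primes(1) q(1)[OF i], of "\<lambda>r. r"] by simp
  then have "\<Prod>Q dvd k i * \<Prod>(Q - {q i})" using q(2)[OF i] by (simp add: mult_dvd_mono)
  then have "int (\<Prod>Q) dvd int (k i) * int (\<Prod>(Q - {q i}))"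
    by (simp only: int_dvd_int_iff of_nat_mult[symmetric])
  then have "int (\<Prod>Q) dvd int (k i) * int (\<Prod>(Q - {q i})) * window_shift (m i) j" by (rule dvd_mult2)
  then show ?thesis using i by (simp add: cong_0_iff mult.assoc)
qed simp

text \<open>
  Since \<open>u\<^sub>1\<close> does not shift, the two sides collect the shifts of \<open>u\<^sub>i\<close> at the odd and at the even
  places of a window of length \<open>m i\<close>; the difference is an alternating sum.
\<close>

lemma odd_shift:
  assumes i: "i \<in> {2..n}"
  shows "shift \<eta> \<epsilon> (alternating (m i) (Ui 1) (Ui i)) j = shift \<eta> \<epsilon> (alternating (m i) (Ui i) (Ui 1)) j"
proof -
  let ?w = "\<lambda>r. int (\<Prod>(Q - {q i})) * window_shift (m i) (j - int r)"
  have 1: "\<epsilon> (if even r then Ui 1 else Ui i) (j - int r) = (if even r then 0 else ?w r)"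
    and 2: "\<epsilon> (if even r then Ui i else Ui 1) (j - int r) = (if even r then ?w r else 0)" for r
    using i by auto
  have "shift \<eta> \<epsilon> (alternating (m i) (Ui i) (Ui 1)) j - shift \<eta> \<epsilon> (alternating (m i) (Ui 1) (Ui i)) j
    = (\<Sum>r<m i. (if even r then ?w r else 0) - (if even r then 0 else ?w r))"
    by (subst (1 2) alternating_shift_descending) (simp_all only: \<eta>.simps 1 2 sum_subtractf)
  also have "\<dots> = (\<Sum>r<m i. int (\<Prod>(Q - {q i})) * ((-1) ^ r * window_shift (m i) (j - int r)))"
    by (intro sum.cong HOL.refl) auto
  also have "\<dots> = 0"
    unfolding sum_distrib_left[symmetric] using window_shift_sum[of "m i" j] l[OF i] by (simp add: m_def)
  finally show ?thesis by simp
qed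

lemma odd_defect_zero_sum:
  assumes "\<And>i j. e i j \<in> zero_sum_functions Q p"
  shows "odd_defect e i j \<in> zero_sum_functions Q p"
proof -
  have e: "edge_weights e s j \<in> zero_sum_functions Q p" for s j
    using assms zero_sum_zero by (cases s) auto
  show ?thesis
    using zero_sum_add[OF weight_zero_sum[of "edge_weights e", OF e] zero_sum_uminus[OF weight_zero_sum[of "edge_weights e", OF e]],
        of \<eta> \<epsilon> "alternating (m i) (Ui 1) (Ui i)" j \<eta> \<epsilon> "alternating (m i) (Ui i) (Ui 1)" j]
    unfolding odd_defect_def[abs_def] by simp
qed

lemma odd_defect_support:
  assumes "\<And>i j x. j < 0 \<or> j \<ge> L \<Longrightarrow> e i j x = 0" "j < 0 \<or> j \<ge> L + int (m i)"
  shows "odd_defect e i j x = 0"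
proof -
  have "edge_weights e s j x = 0" if "j < 0 \<or> j \<ge> L" for s j x
    using assms(1)[OF that] by (cases s) auto
  then show ?thesis unfolding odd_defect_def
    using alternating_weight_support[of \<eta> _ _ L "edge_weights e" j "m i" \<epsilon> x] assms(2) by simp
qed

lemma odd_defect_diff:
  "odd_defect (\<lambda>i j x. e i j x - e' i j x) i j x = odd_defect e i j x - odd_defect e' i j x"
proof -
  have "edge_weights (\<lambda>i j x. e i j x - e' i j x) = (\<lambda>s j x. edge_weights e s j x - edge_weights e' s j x)"
  proof
    fix s show "edge_weights (\<lambda>i j x. e i j x - e' i j x) s = (\<lambda>j x. edge_weights e s j x - edge_weights e' s j x)"
      by (cases s) auto
  qed
  then show ?thesis by (simp add: odd_defect_def weight_diff)
qed

text \<open>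
  The positions at which an admissible family supported in heights \<open>0 \<le> j < L\<close> is free, and those
  at which the defect can be nonzero: the walks of an odd relation descend through \<open>m i\<close> heights.
\<close>

definition unknowns :: "nat \<Rightarrow> (nat \<times> int) set" where
  "unknowns L = {1..n} \<times> {0..<int L} - (SIGMA i:two_powers. {j. j mod int (m i) = 1})"

definition equations :: "nat \<Rightarrow> (nat \<times> int) set" where
  "equations L = (SIGMA i:{2..n}. {0..<int (L + m i)})"

text \<open>
  Each unknown and each equation takes values in the same finite group, so with more unknowns than
  equations two different families of weights have the same defects modulo \<open>p\<close>. The defect is
  additive, and their difference is a nontrivial solution.
\<close>

lemma solution_if_more_unknowns:
  assumes "card (unknowns L) > card (equations L)"
  obtains e i j x where "admissible (int L) e" "\<And>i j x. i \<in> {2..n} \<Longrightarrow> p dvd odd_defect e i j x"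
    "i \<in> {1..n}" "\<not> p dvd e i j x"
proof -
  let ?F = "reduced_zero_sum Q p"
  define ext where "ext c i j = (if (i, j) \<in> unknowns L then c (i, j) else (\<lambda>x::int. 0::int))" for c i j
  \<comment> \<open>The defects, reduced modulo \<open>p\<close> so that they lie in the same finite set as the unknowns.\<close>
  define T where "T c = restrict (\<lambda>(i, j) x. odd_defect (ext c) i j x mod p) (equations L)" for c
  have Q2: "\<And>r. r \<in> Q \<Longrightarrow> r \<ge> 2" using Q_primes prime_ge_2_nat by blast
  have "\<Prod>Q > 0" using Q2 by (intro prod_pos) fastforce
  then have F: "finite ?F" "card ?F \<ge> 2"
    by (rule finite_reduced_zero_sum) (rule card_reduced_zero_sum[OF Q_primes(1) Q2 p])
  have fin: "finite (unknowns L)" "finite (equations L)" by (auto simp: unknowns_def equations_def)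
  have ext_F: "ext c i j \<in> zero_sum_functions Q p" if "c \<in> unknowns L \<rightarrow>\<^sub>E ?F" for c i j
    using PiE_mem[OF that, of "(i, j)"] zero_sum_zero by (auto simp: ext_def reduced_zero_sum_def)
  have "T ` (unknowns L \<rightarrow>\<^sub>E ?F) \<subseteq> equations L \<rightarrow>\<^sub>E ?F"
  proof (rule image_subsetI)
    fix c assume c: "c \<in> unknowns L \<rightarrow>\<^sub>E ?F"
    have "(\<lambda>x. odd_defect (ext c) i j x mod p) \<in> ?F" for i j
      using zero_sum_mod[OF odd_defect_zero_sum[of "ext c", OF ext_F[OF c]]] p
      by (auto simp: reduced_zero_sum_def)
    then show "T c \<in> equations L \<rightarrow>\<^sub>E ?F" by (auto simp: T_def)
  qed
  then have "card (T ` (unknowns L \<rightarrow>\<^sub>E ?F)) \<le> card ?F ^ card (equations L)"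
    using card_mono[OF finite_PiE[OF fin(2)], of "\<lambda>_. ?F"] F(1) by (simp add: card_PiE fin)
  also have "\<dots> < card ?F ^ card (unknowns L)"
    using assms F(2) by (intro power_strict_increasing) auto
  also have "\<dots> = card (unknowns L \<rightarrow>\<^sub>E ?F)" by (simp add: card_PiE fin)
  finally obtain c c' where c: "c \<in> unknowns L \<rightarrow>\<^sub>E ?F" "c' \<in> unknowns L \<rightarrow>\<^sub>E ?F" "c \<noteq> c'" "T c = T c'"
    using pigeonhole[of T "unknowns L \<rightarrow>\<^sub>E ?F"] by (auto simp: inj_on_def)
  define e where "e i j x = ext c i j x - ext c' i j x" for i j x
  have e0: "e i j x = 0" if "(i, j) \<notin> unknowns L" for i j x using that by (simp add: e_def ext_def)
  have supp: "e i j x = 0" if "j < 0 \<or> j \<ge> int L" for i j x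
    using that by (intro e0) (auto simp: unknowns_def)
  have "admissible (int L) e"
    unfolding admissible_def
  proof (intro conjI allI impI ballI)
    show "e i j \<in> zero_sum_functions Q p" for i j
      using zero_sum_add[OF ext_F[OF c(1)] zero_sum_uminus[OF ext_F[OF c(2)]]] unfolding e_def[abs_def] by simp
    show "e i j = (\<lambda>x. 0)" if "j < 0 \<or> int L \<le> j" for i j using supp[OF that] by auto
    show "e i j = (\<lambda>x. 0)" if "i \<in> two_powers" "j mod int (m i) = 1" for i j
      using that by (intro ext e0) (auto simp: unknowns_def)
  qed
  moreover have "p dvd odd_defect e i j x" if i: "i \<in> {2..n}" for i j x
  proof (cases "(i, j) \<in> equations L")
    case True
    then have "odd_defect (ext c) i j x mod p = odd_defect (ext c') i j x mod p"
      using fun_cong[OF fun_cong[OF c(4)], of "(i, j)" x] by (simp add: T_def)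
    then show ?thesis unfolding e_def[abs_def] odd_defect_diff by (simp add: mod_eq_dvd_iff)
  next
    case False
    then have "odd_defect e i j x = 0"
      using i by (intro odd_defect_support[of "int L"] supp) (auto simp: equations_def)
    then show ?thesis by simp
  qed
  moreover obtain i j where ij: "(i, j) \<in> unknowns L" "c (i, j) \<noteq> c' (i, j)"
    using c by (metis PiE_ext surj_pair)
  then obtain x where x: "c (i, j) x \<noteq> c' (i, j) x" by blast
  have "c (i, j) x \<in> {0..<p}" "c' (i, j) x \<in> {0..<p}"
    using PiE_mem[OF c(1) ij(1)] PiE_mem[OF c(2) ij(1)] unfolding reduced_zero_sum_def by blast+
  then have "\<not> p dvd e i j x"
    using x ij(1) by (auto simp: e_def ext_def mod_eq_dvd_iff[symmetric])
  moreover have "i \<in> {1..n}" using ij(1) by (auto simp: unknowns_def)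
  ultimately show thesis using that by blast
qed

text \<open>
  If every \<open>m i\<close> divides \<open>L\<close>, then each \<open>i\<close> in \<open>two_powers\<close> loses \<open>L / m i\<close> of its \<open>L\<close> unknowns, and
  each odd relation has \<open>L + m i\<close> equations. The surplus of unknowns is thus \<open>L\<close> times a positive
  constant minus a constant, and \<open>L\<close> can be any multiple of the product of all \<open>m i\<close>.
\<close>

lemma more_unknowns:
  assumes "(\<Sum>i\<in>two_powers. 1 / real (m i)) < 1"
  obtains L where "card (unknowns L) > card (equations L)"
proof -
  let ?\<sigma> = "\<Sum>i\<in>two_powers. 1 / real (m i)"
  let ?P = "\<Prod>i\<in>{2..n}. m i" and ?M = "\<Sum>i\<in>{2..n}. m i"
  obtain t where t: "real ?M < real t * (1 - ?\<sigma>)"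
    using ex_less_of_nat_mult[of "1 - ?\<sigma>" "real ?M"] assms by auto
  define L where "L = t * ?P"
  have J: "finite two_powers" "two_powers \<subseteq> {2..n}" by (auto simp: two_powers_def)
  have "?P \<ge> 1" by (intro prod_ge_1) (simp add: m_def)
  then have "t * 1 \<le> L" unfolding L_def by (rule mult_le_mono2)
  then have "real L * (1 - ?\<sigma>) \<ge> real t * (1 - ?\<sigma>)"
    using assms by (intro mult_right_mono) simp_all
  with t have L: "real ?M < real L * (1 - ?\<sigma>)" by simp
  \<comment> \<open>The heights \<open>j < L\<close> congruent to \<open>1\<close> are the \<open>m i * r + 1\<close> with \<open>r < L div m i\<close>.\<close>
  have "card ({1..n} \<times> {0..<int L} \<inter> (SIGMA i:two_powers. {j. j mod int (m i) = 1}))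
    \<le> card (SIGMA i:two_powers. (\<lambda>r. int (m i) * int r + 1) ` {..<L div m i})"
  proof (rule card_mono)
    show "finite (SIGMA i:two_powers. (\<lambda>r. int (m i) * int r + 1) ` {..<L div m i})" using J by simp
    show "{1..n} \<times> {0..<int L} \<inter> (SIGMA i:two_powers. {j. j mod int (m i) = 1})
      \<subseteq> (SIGMA i:two_powers. (\<lambda>r. int (m i) * int r + 1) ` {..<L div m i})"
    proof clarify
      fix i j assume i: "i \<in> two_powers" and j: "j \<in> {0..<int L}" "j mod int (m i) = 1"
      have "m i dvd L" using J i dvd_prodI[of "{2..n}" i m] unfolding L_def by (intro dvd_mult) auto
      then have Lm: "L = (L div m i) * m i" by simp
      let ?r = "nat (j div int (m i))"
      have jr: "j = int (m i) * int ?r + 1"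
        using j div_mult_mod_eq[of j "int (m i)"] by (simp add: pos_imp_zdiv_nonneg_iff m_def mult.commute)
      have "int ?r * int (m i) < int (L div m i) * int (m i)"
        using j(1) jr Lm by (metis add.commute atLeastLessThan_iff less_trans mult.commute of_nat_mult zless_add1_eq)
      then have "?r < L div m i" by (simp only: mult_less_cancel_right of_nat_less_iff)
      then show "j \<in> (\<lambda>r. int (m i) * int r + 1) ` {..<L div m i}" using jr by blast
    qed
  qed
  also have "\<dots> = (\<Sum>i\<in>two_powers. card ((\<lambda>r. int (m i) * int r + 1) ` {..<L div m i}))"
    using J by simp
  also have "\<dots> \<le> (\<Sum>i\<in>two_powers. L div m i)"
    by (intro sum_mono) (rule order_trans[OF card_image_le]; simp)
  finally have "card ({1..n} \<times> {0..<int L}) - card (unknowns L) \<le> (\<Sum>i\<in>two_powers. L div m i)"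
    unfolding unknowns_def by (subst card_Diff_subset_Int) auto
  then have "real n * real L \<le> real (card (unknowns L)) + real (\<Sum>i\<in>two_powers. L div m i)"
    by (simp add: card_cartesian_product of_nat_mult[symmetric] del: of_nat_mult of_nat_sum)
  also have "real (\<Sum>i\<in>two_powers. L div m i) \<le> real L * ?\<sigma>"
    unfolding of_nat_sum sum_distrib_left by (intro sum_mono) (simp add: of_nat_div_le_of_nat)
  finally have U: "real n * real L - real L * ?\<sigma> \<le> real (card (unknowns L))" by simp
  have "card (equations L) = (n - 1) * L + ?M" by (simp add: equations_def sum.distrib nat_add_distrib)
  then have "real (card (equations L)) = (real n - 1) * real L + real ?M"
    using n by (simp add: of_nat_diff)
  with U L have "card (equations L) < card (unknowns L)"
    by (simp add: algebra_simps)
  then show thesis by (rule that)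
qed

end

section \<open>The theorem\<close>

lemma alternating_char:
  assumes \<chi>: "\<chi> \<in> hom (presented_group S Rel) real_group" and "s \<in> S" "t \<in> S"
  shows "\<chi> (word_cong S Rel `` {alternating (2 * r + 1) s t})
    = real (r + 1) * \<chi> (presented_gen S Rel s) + real r * \<chi> (presented_gen S Rel t)"
proof (induction r)
  case 0
  then show ?case by (simp add: presented_gen_def)
next
  case (Suc r)
  have alt: "alternating i a b \<in> words S" if "a \<in> S" "b \<in> S" for i a b
    using that by (induction i arbitrary: a b) (auto simp: words_def)
  have w: "[(s, True)] \<in> words S" "[(t, True)] \<in> words S" "[(s, True), (t, True)] \<in> words S"
    using assms(2,3) by (auto simp: words_def)
  have "alternating (2 * Suc r + 1) s t = [(s, True), (t, True)] @ alternating (2 * r + 1) s t" by simp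
  then have "\<chi> (word_cong S Rel `` {alternating (2 * Suc r + 1) s t})
    = \<chi> (presented_gen S Rel s) + \<chi> (presented_gen S Rel t) + \<chi> (word_cong S Rel `` {alternating (2 * r + 1) s t})"
    using presented_group_char_append[OF \<chi> w(3) alt[OF assms(2,3)]]
      presented_group_char_append[OF \<chi> w(1,2)] by (simp add: presented_gen_def del: alternating.simps)
  then show ?case using Suc by (simp add: algebra_simps del: alternating.simps)
qed

theorem propositionA:
  fixes n :: nat and k l :: "nat \<Rightarrow> nat" and \<chi> :: "vertex word set \<Rightarrow> real"
  assumes "n \<ge> 2"
    and "\<forall>i\<in>{1..n}. k i > 1"
    and "\<forall>i\<in>{2..n}. l i > 0"
    and "\<chi> \<in> hom (G_group n k l) real_group"
    and "\<chi> (G_gen n k l (Ui 1)) = -1"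
    and "\<chi> (G_gen n k l U) = 1"
    and "(\<Sum>i | i \<in> {2..n} \<and> (\<exists>e. k i = 2 ^ e). 1 / (2 * real (l i) + 1)) < 1"
  shows "char_class (G_group n k l) \<chi>
    \<in> char_sphere (G_group n k l) - Sigma1 TYPE('m) (G_group n k l)"
proof -
  interpret even_odd_star n k l by unfold_locales (use assms(1-3) in auto)
  let ?S = "G_vertices n" and ?R = "artin_relations (G_edges n k l)"
  have G: "G_group n k l = presented_group ?S ?R" by (simp add: G_group_def artin_group_def)
  have gen: "G_gen n k l s = presented_gen ?S ?R s" for s by (simp add: G_gen_def artin_gen_def)
  have \<chi>: "\<chi> \<in> hom (presented_group ?S ?R) real_group" using assms(4) by (simp add: G)
  have S: "U \<in> ?S" "\<And>i. i \<in> {1..n} \<Longrightarrow> Ui i \<in> ?S" by (auto simp: G_vertices_def)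
  have \<chi>_odd: "\<chi> (presented_gen ?S ?R (Ui i)) = -1" if i: "i \<in> {2..n}" for i
  proof -
    have "(Ui 1, Ui i, m i) \<in> G_edges n k l" using i by (auto simp: G_edges_def m_def)
    from artin_relation_holds[OF labelled_graph_G[OF assms(2,3)] this]
    have "real (l i + 1) * \<chi> (presented_gen ?S ?R (Ui 1)) + real (l i) * \<chi> (presented_gen ?S ?R (Ui i))
      = real (l i + 1) * \<chi> (presented_gen ?S ?R (Ui i)) + real (l i) * \<chi> (presented_gen ?S ?R (Ui 1))"
      using alternating_char[OF \<chi> S(2)[of 1] S(2)[of i], of "l i"]
        alternating_char[OF \<chi> S(2)[of i] S(2)[of 1], of "l i"] i by (simp add: m_def)
    then show ?thesis using assms(5) by (simp add: gen algebra_simps)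
  qed
  have gens: "\<chi> (presented_gen ?S ?R s) = real_of_int (\<eta> s)" if s: "s \<in> ?S" for s
  proof (cases s)
    case U
    then show ?thesis using assms(6) by (simp add: gen)
  next
    case (Ui i)
    then have "i \<in> {1..n}" using s by (auto simp: G_vertices_def)
    then show ?thesis using Ui assms(5) \<chi>_odd by (cases "i = 1") (auto simp: gen)
  qed
  have "(\<Sum>i\<in>two_powers. 1 / real (m i)) < 1" using assms(7) by (simp add: two_powers_def m_def add.commute)
  then obtain L where "card (unknowns L) > card (equations L)" by (rule more_unknowns)
  then obtain e i0 j0 x0 where e: "admissible (int L) e"
    and defect: "\<And>i j x. i \<in> {2..n} \<Longrightarrow> p dvd odd_defect e i j x"
    and nz: "i0 \<in> {1..n}" "\<not> p dvd e i0 j0 x0"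
    using solution_if_more_unknowns[of L] by metis
  let ?d = "edge_weights e"
  have rels: "height \<eta> a = height \<eta> b \<and> [shift \<eta> \<epsilon> a j = shift \<eta> \<epsilon> b j] (mod int (\<Prod>Q))
      \<and> [weight \<eta> \<epsilon> ?d a j x = weight \<eta> \<epsilon> ?d b j x] (mod p)" if ab: "(a, b) \<in> ?R" for a b j x
  proof -
    consider i where "i \<in> {1..n}" "a = alternating (2 * k i) U (Ui i)" "b = alternating (2 * k i) (Ui i) U"
      | i where "i \<in> {2..n}" "a = alternating (m i) (Ui 1) (Ui i)" "b = alternating (m i) (Ui i) (Ui 1)"
      using ab unfolding artin_relations_def G_edges_def m_def by blast
    then show ?thesis
    proof cases
      case 1
      have "[int (k i) * \<epsilon> (Ui i) (j + 1) = int (k i) * \<epsilon> (Ui i) j] (mod int (\<Prod>Q))"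
        using even_shift[OF 1(1)] by (metis cong_sym cong_trans)
      moreover have "[(\<Sum>r<k i. e i (j + 1) (x + int r * \<epsilon> (Ui i) (j + 1)))
          = (\<Sum>r<k i. e i j (x + int r * \<epsilon> (Ui i) j))] (mod p)"
        using even_sum[OF e 1(1)] by (meson cong_0_iff cong_sym cong_trans)
      ultimately show ?thesis
        using alternating_even_walk[of \<eta> U \<epsilon> ?d "Ui i" "k i"] by (simp add: 1 del: \<epsilon>.simps(2))
    next
      case 2
      then show ?thesis
        using alternating_height[of \<eta> "Ui 1" "-1" "Ui i"] alternating_height[of \<eta> "Ui i" "-1" "Ui 1"]
          odd_shift[OF 2(1)] defect[OF 2(1), of j x]
        by (simp add: odd_defect_def cong_iff_dvd_diff)
    qed
  qed
  show ?thesis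
    unfolding G
  proof (rule Sigma1_complement_of_weighted_walk[where \<eta> = \<eta> and \<epsilon> = \<epsilon> and d = ?d and p = p
        and Q = "int (\<Prod>Q)" and L = "int L" and u = U and t = "Ui i0"])
    show "?d s j x = ?d s j y" if "[x = y] (mod int (\<Prod>Q))" for s j x y
      using zero_sum_functionsD(1)[OF admissible_edge_weights(1)[OF e] that] .
    show "?d s j x = 0" if "j \<ge> int L" for s j x
      using admissible_edge_weights(2)[OF e] that by blast
    show "\<not> p dvd ?d (Ui i0) j0 x0" using nz by simp
  qed (use rels \<chi> gens S nz in auto)
qed

end
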